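(* Let $\mathbf a_1,\mathbf a_2$ be two coefficient vectors taking values in $\mathbf D$, and let $(\mathbf m^{(i)},\bar\rho^{(i)})$, $i=1,2$, be two solutions of the weak problem: $(\mathbf m^{(i)},\bar\rho^{(i)}):I\to V\times Q$, $$\big(F(\mathbf a_i,|\mathbf m^{(i)}|)\mathbf m^{(i)},\mathbf v\big)-(\bar\rho^{(i)},\nabla\cdot\mathbf v)=-(\nabla\Psi,\mathbf v)\quad\text{for all }\mathbf v\in V,$$ $$(\phi\,\bar\rho_t^{(i)},q)+(\nabla\cdot\mathbf m^{(i)},q)=(f,q)-(\phi\Psi_t,q)\quad\text{for all }q\in Q,$$ corresponding to the coefficient vectors $\mathbf a_i$ of the generalized polynomial $F(\mathbf a_i,\cdot)$, with the same boundary data $\psi$ (extended by $\Psi$) and the same initial data $\rho_0$ (so $\bar\rho^{(i)}(\cdot,0)=\rho_0-\Psi(\cdot,0)$ for $i=1,2$). Then there exists a constant $C>0$ such that $$\|\bar\rho^{(1)}-\bar\rho^{(2)}\|_{L^\infty(I,L^2(\Omega))}^2+\|\mathbf m^{(1)}-\mathbf m^{(2)}\|_{L^s(I,L^s(\Omega))}^s\le C\,\|\mathbf a_1-\mathbf a_2\|_{L^\infty(I,L^\infty(\Omega))}^{s^*}.$$ Here, as in the analogous statement for the discrete problem, $C$ is independent of $\|\mathbf a_1-\mathbf a_2\|_{L^\infty(I,L^\infty(\Omega))}$.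
   Context: $\Omega\subset\mathbb R^d$ ($d\ge2$) is open, bounded, with $C^1$ boundary; $T>0$, $I=[0,T]$; $(\cdot,\cdot)$ is the integral pairing over $\Omega$ of scalar or vector functions; subscript $t$ denotes time derivative. Solutions are assumed to have enough regularity in $\mathbf x$ and $t$ for the expressions to make sense. Fix $N\ge1$ and real exponents $\alpha_{-1}=-\alpha<\alpha_0=0<\alpha_1<\dots<\alpha_N$ with $\alpha\in(0,1)$; put $s=\alpha_N+2$, $s^*=s/(s-1)$. For a vector of coefficient functions $\mathbf a=(a_{-1},a_0,\dots,a_N)$ on $\Omega\times I$, $F(\mathbf a,z)=\sum_{i=-1}^N a_i(\mathbf x,t)z^{\alpha_i}$, and $F(\mathbf a,|\mathbf m|)\mathbf m$ is understood as $0$ where $\mathbf m=0$. $\mathbf D$ is a compact subset of $\{(a_{-1},a_0,\dots,a_N):0<a_*\le a_{-1},a_0,a_N\le a^*,\ 0\le a_1,\dots,a_{N-1}\le a^*\}$, with $0<a_*\le a^*<\infty$ fixed. Coefficients are assumed to lie in $W^{1,\infty}(I,L^\infty(\Omega))$ with $|\partial_ta_i|<b^*<\infty$. Data: $0<\phi_*\le\phi(\mathbf x)\le\phi^*<\infty$; $f\in L^\infty(I,L^2(\Omega))$; $\psi\in C^{1,2}_{\mathbf x,t}(\bar\Omega\times I)$; $\Psi$ is an extension of the boundary datum $\psi$ from $\partial\Omega\times I$ to $\bar\Omega\times I$; $\rho_0$ is the initial density. Spaces: $Q=L^2(\Omega)$; $V=\{\mathbf v\in(L^s(\Omega))^d:\nabla\cdot\mathbf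 v\in L^2(\Omega)\}$ with norm $\|\mathbf v\|_V=\|\mathbf v\|_{L^s(\Omega)}+\|\nabla\cdot\mathbf v\|_{L^2(\Omega)}$. *)

theory Defs
  imports "HOL-Probability.Essential_Supremum"
begin

section \<open>Classical differentiability\<close>

definition grad :: "('a::real_inner \<Rightarrow> real) \<Rightarrow> 'a \<Rightarrow> 'a" where
  "grad g x = (THE D. GDERIV g x :> D)"

fun C_k :: "nat \<Rightarrow> (real^'d \<Rightarrow> real) \<Rightarrow> bool" where
  "C_k 0 g \<longleftrightarrow> continuous_on UNIV g"
| "C_k (Suc k) g \<longleftrightarrow>
     (\<exists>G. (\<forall>x. GDERIV g x :> G x) \<and> (\<forall>i. C_k k (\<lambda>x. G x $ i)))"

definition test_function :: "(real^'d) set \<Rightarrow> (real^'d \<Rightarrow> real) \<Rightarrow> bool" where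
  "test_function \<Omega> \<eta> \<longleftrightarrow>
     (\<forall>k. C_k k \<eta>) \<and> compact (closure {x. \<eta> x \<noteq> 0}) \<and> closure {x. \<eta> x \<noteq> 0} \<subseteq> \<Omega>"

text \<open>Near each boundary point the set is, in the direction of some unit vector \<open>e\<close>, the strict
  epigraph of a continuously differentiable function on the hyperplane orthogonal to \<open>e\<close>;
  \<open>x - (x \<bullet> e) *\<^sub>R e\<close> is the projection of \<open>x\<close> to that hyperplane, so the choice of \<open>e\<close> plays the
  role of the usual rotation of the coordinate axes.\<close>

definition C1_boundary :: "(real^'d) set \<Rightarrow> bool" where
  "C1_boundary \<Omega> \<longleftrightarrow>
     (\<forall>x0 \<in> frontier \<Omega>. \<exists>r>0. \<exists>e \<gamma>. norm e = 1 \<and> C_k 1 \<gamma> \<and>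
        \<Omega> \<inter> ball x0 r = {x \<in> ball x0 r. \<gamma> (x - (x \<bullet> e) *\<^sub>R e) < x \<bullet> e})"

text \<open>Functions of space and time take the time variable first, so that \<open>u t\<close> is a function on
  \<open>\<Omega>\<close>. The time derivative on \<open>[0,T]\<close> is one-sided at the two end points.\<close>

definition dt :: "real \<Rightarrow> (real \<Rightarrow> 'a \<Rightarrow> real) \<Rightarrow> real \<Rightarrow> 'a \<Rightarrow> real" where
  "dt T u t x = vector_derivative (\<lambda>\<tau>. u \<tau> x) (at t within {0..T})"

text \<open>\<open>C12 \<Omega> T\<close> is the class of functions that are once continuously differentiable in space and
  twice in time, where all these derivatives extend continuously from \<open>[0,T] \<times> \<Omega>\<close> to
  \<open>[0,T] \<times> closure \<Omega>\<close>.\<close>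

definition C12 :: "(real^'d) set \<Rightarrow> real \<Rightarrow> (real \<Rightarrow> real^'d \<Rightarrow> real) \<Rightarrow> bool" where
  "C12 \<Omega> T u \<longleftrightarrow>
     continuous_on ({0..T} \<times> closure \<Omega>) (\<lambda>(t, x). u t x) \<and>
     (\<exists>G u' u''.
        continuous_on ({0..T} \<times> closure \<Omega>) (\<lambda>(t, x). G t x) \<and>
        continuous_on ({0..T} \<times> closure \<Omega>) (\<lambda>(t, x). u' t x) \<and>
        continuous_on ({0..T} \<times> closure \<Omega>) (\<lambda>(t, x). u'' t x) \<and>
        (\<forall>t\<in>{0..T}. \<forall>x\<in>\<Omega>.
           (GDERIV (u t) x :> G t x) \<and>
           ((\<lambda>\<tau>. u \<tau> x) has_real_derivative u' t x) (at t within {0..T}) \<and>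
           ((\<lambda>\<tau>. u' \<tau> x) has_real_derivative u'' t x) (at t within {0..T})))"


section \<open>Lebesgue and Bochner spaces\<close>

text \<open>The norms below are real-valued and meaningful only for members of the corresponding space.\<close>

definition Lp_space :: "real \<Rightarrow> 'a measure \<Rightarrow> ('a \<Rightarrow> 'b::real_normed_vector) set" where
  "Lp_space p M = {u \<in> borel_measurable M. integrable M (\<lambda>x. norm (u x) powr p)}"

definition Lp_norm :: "real \<Rightarrow> 'a measure \<Rightarrow> ('a \<Rightarrow> 'b::real_normed_vector) \<Rightarrow> real" where
  "Lp_norm p M u = (\<integral>x. norm (u x) powr p \<partial>M) powr (1 / p)"

definition Linf_space :: "'a measure \<Rightarrow> ('a \<Rightarrow> 'b::real_normed_vector) set" where
  "Linf_space M = {u \<in> borel_measurable M. esssup M (\<lambda>x. ereal (norm (u x))) < \<infinity>}"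

definition Linf_norm :: "'a measure \<Rightarrow> ('a \<Rightarrow> 'b::real_normed_vector) \<Rightarrow> real" where
  "Linf_norm M u = real_of_ereal (esssup M (\<lambda>x. ereal (norm (u x))))"

definition space_time :: "real \<Rightarrow> (real^'d) set \<Rightarrow> (real \<times> (real^'d)) measure" where
  "space_time T \<Omega> = lebesgue_on {0..T} \<Otimes>\<^sub>M lebesgue_on \<Omega>"

text \<open>Elements of \<open>L\<^sup>p([0,T], L\<^sup>q(\<Omega>))\<close> are given by jointly measurable representatives.\<close>

definition Lp_Lq_space ::
  "real \<Rightarrow> real \<Rightarrow> real \<Rightarrow> (real^'d) set \<Rightarrow> (real \<Rightarrow> real^'d \<Rightarrow> 'b::real_normed_vector) set" where
  "Lp_Lq_space p q T \<Omega> =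
     {u. (\<lambda>(t, x). u t x) \<in> borel_measurable (space_time T \<Omega>) \<and>
         (AE t in lebesgue_on {0..T}. u t \<in> Lp_space q (lebesgue_on \<Omega>)) \<and>
         (\<lambda>t. Lp_norm q (lebesgue_on \<Omega>) (u t)) \<in> Lp_space p (lebesgue_on {0..T})}"

definition Linf_Lq_space ::
  "real \<Rightarrow> real \<Rightarrow> (real^'d) set \<Rightarrow> (real \<Rightarrow> real^'d \<Rightarrow> 'b::real_normed_vector) set" where
  "Linf_Lq_space q T \<Omega> =
     {u. (\<lambda>(t, x). u t x) \<in> borel_measurable (space_time T \<Omega>) \<and>
         (AE t in lebesgue_on {0..T}. u t \<in> Lp_space q (lebesgue_on \<Omega>)) \<and>
         (\<lambda>t. Lp_norm q (lebesgue_on \<Omega>) (u t)) \<in> Linf_space (lebesgue_on {0..T})}"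

definition Lp_Lq_norm ::
  "real \<Rightarrow> real \<Rightarrow> real \<Rightarrow> (real^'d) set \<Rightarrow> (real \<Rightarrow> real^'d \<Rightarrow> 'b::real_normed_vector) \<Rightarrow> real" where
  "Lp_Lq_norm p q T \<Omega> u =
     Lp_norm p (lebesgue_on {0..T}) (\<lambda>t. Lp_norm q (lebesgue_on \<Omega>) (u t))"

definition Linf_Lq_norm ::
  "real \<Rightarrow> real \<Rightarrow> (real^'d) set \<Rightarrow> (real \<Rightarrow> real^'d \<Rightarrow> 'b::real_normed_vector) \<Rightarrow> real" where
  "Linf_Lq_norm q T \<Omega> u =
     Linf_norm (lebesgue_on {0..T}) (\<lambda>t. Lp_norm q (lebesgue_on \<Omega>) (u t))"

definition Linf_Linf_norm ::
  "real \<Rightarrow> (real^'d) set \<Rightarrow> (real \<Rightarrow> real^'d \<Rightarrow> 'b::real_normed_vector) \<Rightarrow> real" where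
  "Linf_Linf_norm T \<Omega> u =
     Linf_norm (lebesgue_on {0..T}) (\<lambda>t. Linf_norm (lebesgue_on \<Omega>) (u t))"

text \<open>The identity \<open>u(t) = u(0) + \<integral>\<^sub>0\<^sup>t u'(\<tau>) d\<tau>\<close> between functions on \<open>\<Omega>\<close> (modulo null sets) for every
  \<open>t\<close>: \<open>u'\<close> is the weak time derivative of \<open>u\<close>, and \<open>u\<close> is its (unique) representative that is
  absolutely continuous in time, so that initial values make sense.\<close>

definition has_time_derivative ::
  "real \<Rightarrow> (real^'d) set \<Rightarrow> (real \<Rightarrow> real^'d \<Rightarrow> real) \<Rightarrow> (real \<Rightarrow> real^'d \<Rightarrow> real) \<Rightarrow> bool" where
  "has_time_derivative T \<Omega> u u' \<longleftrightarrow>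
     (\<lambda>(t, x). u t x) \<in> borel_measurable (space_time T \<Omega>) \<and>
     (\<lambda>(t, x). u' t x) \<in> borel_measurable (space_time T \<Omega>) \<and>
     (\<forall>t\<in>{0..T}. AE x in lebesgue_on \<Omega>.
        integrable (lebesgue_on {0..t}) (\<lambda>\<tau>. u' \<tau> x) \<and>
        u t x = u 0 x + (\<integral>\<tau>. u' \<tau> x \<partial>lebesgue_on {0..t}))"

definition pairing :: "(real^'d) set \<Rightarrow> (real^'d \<Rightarrow> 'b::real_inner) \<Rightarrow> (real^'d \<Rightarrow> 'b) \<Rightarrow> real" where
  "pairing \<Omega> u v = (\<integral>x. u x \<bullet> v x \<partial>lebesgue_on \<Omega>)"

definition has_weak_divergence ::
  "(real^'d) set \<Rightarrow> (real^'d \<Rightarrow> real^'d) \<Rightarrow> (real^'d \<Rightarrow> real) \<Rightarrow> bool" where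
  "has_weak_divergence \<Omega> v w \<longleftrightarrow>
     (\<forall>\<eta>. test_function \<Omega> \<eta> \<longrightarrow> pairing \<Omega> v (grad \<eta>) = - pairing \<Omega> w \<eta>)"

text \<open>\<open>V_with_div \<Omega> s v w\<close> states that \<open>v\<close> belongs to the space
  \<open>V = {v \<in> (L\<^sup>s)\<^sup>d. div v \<in> L\<^sup>2}\<close> and that \<open>w\<close> is (a representative of) \<open>div v\<close>.\<close>

definition V_with_div ::
  "(real^'d) set \<Rightarrow> real \<Rightarrow> (real^'d \<Rightarrow> real^'d) \<Rightarrow> (real^'d \<Rightarrow> real) \<Rightarrow> bool" where
  "V_with_div \<Omega> s v w \<longleftrightarrow>
     v \<in> Lp_space s (lebesgue_on \<Omega>) \<and> w \<in> Lp_space 2 (lebesgue_on \<Omega>) \<and>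
     has_weak_divergence \<Omega> v w"


section \<open>Generalized polynomials and their coefficients\<close>

text \<open>Vectors indexed by \<open>-1, 0, \<dots>, N\<close> are functions on \<open>int\<close>, only whose values on
  \<open>{-1..int N}\<close> matter. Note that \<open>0 powr 0 = 0\<close>; the value of \<open>F\<close> at \<open>z = 0\<close> is irrelevant below,
  since \<open>F\<close> only occurs in products \<open>F(a,|m|) m\<close>, which vanish for \<open>m = 0\<close>.\<close>

definition F :: "nat \<Rightarrow> (int \<Rightarrow> real) \<Rightarrow> (int \<Rightarrow> real) \<Rightarrow> real \<Rightarrow> real" where
  "F N \<alpha> a z = (\<Sum>i\<in>{-1..int N}. a i * z powr \<alpha> i)"

definition coeff_box :: "nat \<Rightarrow> real \<Rightarrow> real \<Rightarrow> (int \<Rightarrow> real) set" where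
  "coeff_box N amin amax =
     {a \<in> extensional {-1..int N}.
        (\<forall>i\<in>{-1, 0, int N}. amin \<le> a i \<and> a i \<le> amax) \<and>
        (\<forall>i\<in>{1..<int N}. 0 \<le> a i \<and> a i \<le> amax)}"

definition admissible_coeff ::
  "real \<Rightarrow> (real^'d) set \<Rightarrow> nat \<Rightarrow> (int \<Rightarrow> real) set \<Rightarrow> real \<Rightarrow> (real \<Rightarrow> real^'d \<Rightarrow> int \<Rightarrow> real) \<Rightarrow> bool" where
  "admissible_coeff T \<Omega> N D b a \<longleftrightarrow>
     (AE (t, x) in space_time T \<Omega>. a t x \<in> D) \<and>
     (\<forall>i\<in>{-1..int N}. \<exists>a'.
        has_time_derivative T \<Omega> (\<lambda>t x. a t x i) a' \<and>
        (AE (t, x) in space_time T \<Omega>. \<bar>a' t x\<bar> < b))"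

definition coeff_dist ::
  "real \<Rightarrow> (real^'d) set \<Rightarrow> nat \<Rightarrow> (real \<Rightarrow> real^'d \<Rightarrow> int \<Rightarrow> real) \<Rightarrow> (real \<Rightarrow> real^'d \<Rightarrow> int \<Rightarrow> real) \<Rightarrow> real" where
  "coeff_dist T \<Omega> N a1 a2 =
     Linf_Linf_norm T \<Omega> (\<lambda>t x. L2_set (\<lambda>i. a1 t x i - a2 t x i) {-1..int N})"


section \<open>The weak problem\<close>

text \<open>Regularity: \<open>m \<in> L\<^sup>s([0,T], L\<^sup>s(\<Omega>))\<close> with \<open>m(t) \<in> V\<close> for almost every \<open>t\<close>, and
  \<open>\<rho> \<in> W\<^sup>1\<^sup>,\<^sup>1([0,T], L\<^sup>2(\<Omega>))\<close>. The equations hold for almost every \<open>t\<close>, with an exceptional set not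
  depending on the test functions; \<open>w\<close> stands for the divergence of \<open>v\<close>, and \<open>divm\<close> for
  that of \<open>m(t)\<close>.\<close>

definition weak_solution ::
  "real \<Rightarrow> (real^'d) set \<Rightarrow> nat \<Rightarrow> (int \<Rightarrow> real) \<Rightarrow> (real^'d \<Rightarrow> real) \<Rightarrow> (real \<Rightarrow> real^'d \<Rightarrow> real) \<Rightarrow>
   (real \<Rightarrow> real^'d \<Rightarrow> real) \<Rightarrow> (real^'d \<Rightarrow> real) \<Rightarrow> (real \<Rightarrow> real^'d \<Rightarrow> int \<Rightarrow> real) \<Rightarrow>
   (real \<Rightarrow> real^'d \<Rightarrow> real^'d) \<Rightarrow> (real \<Rightarrow> real^'d \<Rightarrow> real) \<Rightarrow> bool" where
  "weak_solution T \<Omega> N \<alpha> \<phi> f \<Psi> \<rho>0 a m \<rho> \<longleftrightarrow>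
     (let s = \<alpha> (int N) + 2 in
       m \<in> Lp_Lq_space s s T \<Omega> \<and>
       (\<forall>t\<in>{0..T}. \<rho> t \<in> Lp_space 2 (lebesgue_on \<Omega>)) \<and>
       (AE x in lebesgue_on \<Omega>. \<rho> 0 x = \<rho>0 x - \<Psi> 0 x) \<and>
       (\<exists>\<rho>'. has_time_derivative T \<Omega> \<rho> \<rho>' \<and> \<rho>' \<in> Lp_Lq_space 1 2 T \<Omega> \<and>
         (AE t in lebesgue_on {0..T}.
            (\<forall>v w. V_with_div \<Omega> s v w \<longrightarrow>
               pairing \<Omega> (\<lambda>x. F N \<alpha> (a t x) (norm (m t x)) *\<^sub>R m t x) v - pairing \<Omega> (\<rho> t) w
                 = - pairing \<Omega> (grad (\<Psi> t)) v) \<and>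
            (\<exists>divm. V_with_div \<Omega> s (m t) divm \<and>
               (\<forall>q \<in> Lp_space 2 (lebesgue_on \<Omega>).
                  pairing \<Omega> (\<lambda>x. \<phi> x * \<rho>' t x) q + pairing \<Omega> divm q
                    = pairing \<Omega> (f t) q - pairing \<Omega> (\<lambda>x. \<phi> x * dt T \<Psi> t x) q)))))"

end

theory Submission
  imports Defs
begin

text \<open>Test the difference of the two momentum equations with the difference of the fluxes and the
  difference of the two mass equations with the difference \<open>\<rho>\<close> of the densities; the divergence terms
  cancel. Since \<open>y \<mapsto> F(a,|y|) y\<close> is monotone, with gain \<open>c |y - z|\<^sup>s\<close> coming from the leading term, what
  remains is \<open>d/dt \<integral>\<phi> \<rho>\<^sup>2 + c \<integral>|m1 - m2|\<^sup>s \<le> C |a1 - a2|\<^sup>s\<^sup>* (|\<Omega>| + \<integral>|m2|\<^sup>s)\<close>, by Young's inequality and the growth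
  \<open>F(a,z) z = O(1 + z\<^sup>s\<^sup>-\<^sup>1)\<close>. The space-time integral of \<open>|m2|\<^sup>s\<close> is bounded in terms of the data alone, by
  testing the equations of a single solution with that solution. The time derivative of the energy is
  justified by Fubini's theorem on a triangle, because \<open>\<rho>\<close> is only a time integral of \<open>\<rho>'\<close>.\<close>


section \<open>The constitutive law\<close>

text \<open>The exponent \<open>s / (s - 1)\<close> is the conjugate of \<open>s\<close>. Inserting
  F(a1,|m2|) m2 between the two fluxes leaves a monotone part and the error (F(a1,|m2|) -
  F(a2,|m2|)) m2, paired with m1 - m2. Young's inequality moves |m1 - m2|^s to the left and raises
  the error to the conjugate power. Since |m2|^(s-1) then becomes |m2|^s, and no power of |m1|
  appears, one a priori bound is enough; it must not depend on the solution because \<open>C\<close>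
  is fixed before the solutions are. Two obstacles come from the function spaces. The formula u(t) =
  u(0) + integral of u' holds off a null set of points that may change with t, so Fubini has to act
  on a representative defined everywhere. And the sup norms pass through
  \<open>real_of_ereal\<close>, which sends infinity to 0, and infinity is also the essential
  supremum of a non-measurable function. That \<open>coeff_dist\<close> really dominates the
  coefficient difference therefore rests on measurability of slicewise essential suprema and on a
  finite bound.\<close>

lemma powr_monotone:
  fixes y z :: "'a::real_inner"
  assumes "- 1 \<le> p"
  shows "0 \<le> (norm y powr p *\<^sub>R y - norm z powr p *\<^sub>R z) \<bullet> (y - z)"
proof -
  let ?u = "norm y" and ?v = "norm z"
  \<comment> \<open>Expanding the claim leaves \<open>y \<bullet> z\<close> only in this mixed term.
    Cauchy-Schwarz reduces the rest to a scalar product, nonnegative because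
    \<open>u powr (1 + p)\<close> is nondecreasing as soon as \<open>1 + p \<ge> 0\<close>; this
    admits negative exponents such as \<open>\<alpha> (- 1)\<close>.\<close>
  have "(?u powr p + ?v powr p) * (y \<bullet> z) \<le> (?u powr p + ?v powr p) * (?u * ?v)"
    by (intro mult_left_mono norm_cauchy_schwarz) auto
  moreover have "0 \<le> (?u powr (1 + p) - ?v powr (1 + p)) * (?u - ?v)"
    using powr_mono2[of "1 + p" ?u ?v] powr_mono2[of "1 + p" ?v ?u] assms
    by (cases "?u \<le> ?v") (auto intro: mult_nonneg_nonneg mult_nonpos_nonpos)
  then have "0 \<le> (?u * ?u powr p - ?v * ?v powr p) * (?u - ?v)"
    by (simp add: powr_mult_base)
  ultimately show ?thesis
    by (simp add: inner_diff inner_commute[of z y] dot_square_norm power2_eq_square algebra_simps)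
qed

text \<open>Twice the inner product equals (|y|^p + |z|^p) |y-z|^2 + (|y|^p - |z|^p) (|y|^2 -
  |z|^2), and the last product is nonnegative for \<open>p \<ge> 0\<close>. The constant combines
  this factor 2 with |y-z|^p <= 2^p (|y|^p + |z|^p).\<close>

lemma powr_strongly_monotone:
  fixes y z :: "'a::real_inner"
  assumes "0 \<le> p"
  shows "2 powr (- (p + 1)) * norm (y - z) powr (p + 2)
    \<le> (norm y powr p *\<^sub>R y - norm z powr p *\<^sub>R z) \<bullet> (y - z)"
proof -
  let ?u = "norm y" and ?v = "norm z"
  have "norm (y - z) powr p \<le> (2 * max ?u ?v) powr p"
    using norm_triangle_ineq4[of y z] assms by (intro powr_mono2) auto
  also have "\<dots> = 2 powr p * (max ?u ?v) powr p"
    by (simp add: powr_mult)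
  also have "\<dots> \<le> 2 powr p * (?u powr p + ?v powr p)"
    by (auto simp: max_def)
  finally have le: "2 powr (- (p + 1)) * norm (y - z) powr p \<le> (?u powr p + ?v powr p) / 2"
    unfolding powr_minus powr_add by (simp add: field_simps)
  have "0 \<le> (?u powr p - ?v powr p) * (?u\<^sup>2 - ?v\<^sup>2)"
    using powr_mono2[of p ?u ?v] powr_mono2[of p ?v ?u] power_mono[of ?u ?v 2]
      power_mono[of ?v ?u 2] assms
    by (cases "?u \<le> ?v") (auto intro: mult_nonneg_nonneg mult_nonpos_nonpos)
  then have "(?u powr p + ?v powr p) / 2 * (norm (y - z))\<^sup>2
      \<le> (norm y powr p *\<^sub>R y - norm z powr p *\<^sub>R z) \<bullet> (y - z)"
    by (simp add: power2_norm_eq_inner inner_diff inner_commute[of z y] field_simps)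
  moreover have "norm (y - z) powr (p + 2) = norm (y - z) powr p * (norm (y - z))\<^sup>2"
    by (simp add: powr_add powr_numeral)
  ultimately show ?thesis
    using mult_right_mono[OF le, of "(norm (y - z))\<^sup>2"] by (simp add: mult.assoc)
qed

text \<open>Young's inequality with a prescribed weight \<open>c\<close> and no attempt at an
  optimal constant: either \<open>B\<close> is at most \<open>c * A powr (s - 1)\<close> and the
  first term suffices, or \<open>A\<close> is bounded by a power of \<open>B / c\<close> and the
  second one does.\<close>

lemma mult_le_absorb_powr:
  fixes c s A B :: real
  assumes "0 < c" "1 < s" "0 \<le> A" "0 \<le> B"
  shows "A * B \<le> c * A powr s + (1 / c) powr (1 / (s - 1)) * B powr (s / (s - 1))"
proof (cases "B \<le> c * A powr (s - 1)")
  case True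
  then have "A * B \<le> c * (A * A powr (s - 1))"
    using mult_left_mono[OF True, of A] assms by (simp add: mult.left_commute)
  also have "\<dots> = c * A powr s"
    using assms by (simp add: powr_mult_base)
  finally show ?thesis
    by (simp add: add_increasing2)
next
  case False
  then have "A powr (s - 1) \<le> 1 / c * B"
    using assms by (simp add: field_simps)
  then have "(A powr (s - 1)) powr (1 / (s - 1)) \<le> (1 / c * B) powr (1 / (s - 1))"
    using assms by (intro powr_mono2) auto
  then have "A \<le> (1 / c) powr (1 / (s - 1)) * B powr (1 / (s - 1))"
    using assms unfolding powr_powr by (simp add: powr_divide)
  then have "A * B \<le> (1 / c) powr (1 / (s - 1)) * (B * B powr (1 / (s - 1)))"
    using assms by (auto dest: mult_right_mono[of A _ B] simp: ac_simps)
  also have "B * B powr (1 / (s - 1)) = B powr (s / (s - 1))"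
    using assms by (simp add: powr_mult_base field_simps)
  finally show ?thesis
    using assms by (simp add: add_increasing)
qed

text \<open>Growth of order \<open>s - 1\<close>, raised to the conjugate exponent, has order
  \<open>s\<close>, which is integrable for the fluxes.\<close>

lemma one_plus_powr_conjugate_le:
  fixes s z :: real
  assumes "1 < s" "0 \<le> z"
  shows "(1 + z powr (s - 1)) powr (s / (s - 1)) \<le> 2 powr (s / (s - 1)) * (1 + z powr s)"
proof -
  have "(1 + z powr (s - 1)) powr (s / (s - 1)) \<le> (2 * max 1 (z powr (s - 1))) powr (s / (s - 1))"
    using assms by (intro powr_mono2) auto
  also have "\<dots> = 2 powr (s / (s - 1)) * max 1 (z powr (s - 1)) powr (s / (s - 1))"
    by (simp add: powr_mult)
  also have "max 1 (z powr (s - 1)) powr (s / (s - 1)) \<le> 1 + z powr s"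
    using assms by (auto simp: max_def powr_powr)
  finally show ?thesis by simp
qed

section \<open>Monotonicity, growth and coefficient dependence of the generalized polynomial\<close>

locale generalized_polynomial =
  fixes N :: nat and \<alpha> :: "int \<Rightarrow> real" and amin amax s :: real
  assumes N_ge: "1 \<le> N" and alpha_gt: "- 1 < \<alpha> (- 1)" and alpha_0: "\<alpha> 0 = 0"
    and alpha_mono: "strict_mono_on {-1..int N} \<alpha>"
    and amin_pos: "0 < amin" and s_eq: "s = \<alpha> (int N) + 2"
begin

lemma s_gt_2: "2 < s"
  using strict_mono_onD[OF alpha_mono, of 0 "int N"] N_ge alpha_0 s_eq by simp

lemma alpha_bounds:
  assumes "i \<in> {-1..int N}"
  shows "- 1 < \<alpha> i" "\<alpha> i + 1 \<le> s - 1"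
  using strict_mono_on_leD[OF alpha_mono, of "-1" i] strict_mono_on_leD[OF alpha_mono, of i "int N"]
    assms alpha_gt s_eq by auto

lemma coeff_box_bounds:
  assumes "a \<in> coeff_box N amin amax" "i \<in> {-1..int N}"
  shows "0 \<le> a i" "a i \<le> amax"
proof -
  have "i \<in> {-1, 0, int N} \<or> i \<in> {1..<int N}"
    using assms(2) by auto
  then show "0 \<le> a i" "a i \<le> amax"
    using assms(1) amin_pos by (auto simp: coeff_box_def)
qed

text \<open>The extra factor \<open>z\<close> lifts every exponent into (0, s-1]: the singular index
  -1 becomes harmless near 0, and the leading power dominates for \<open>z > 1\<close>.\<close>

lemma norm_powr_alpha_le:
  assumes "i \<in> {-1..int N}" "0 \<le> z"
  shows "z powr \<alpha> i * z \<le> 1 + z powr (s - 1)"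
proof -
  have "z powr \<alpha> i * z = z powr (\<alpha> i + 1)"
    using assms powr_mult_base[of z "\<alpha> i"] by (simp add: ac_simps)
  also have "\<dots> \<le> 1 + z powr (s - 1)"
  proof (cases "z \<le> 1")
    case True
    then have "z powr (\<alpha> i + 1) \<le> 1 powr (\<alpha> i + 1)"
      using assms alpha_bounds[of i] by (intro powr_mono2) auto
    then show ?thesis by (simp add: add_increasing2)
  next
    case False
    then show ?thesis
      using alpha_bounds[of i] assms by (simp add: powr_mono add_increasing)
  qed
  finally show ?thesis .
qed

lemma F_scaleR: "F N \<alpha> a (norm y) *\<^sub>R y = (\<Sum>i\<in>{-1..int N}. a i *\<^sub>R (norm y powr \<alpha> i *\<^sub>R y))"
  by (simp add: F_def scaleR_sum_left)

text \<open>Only the leading term supplies the gain, its coefficient being at least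
  \<open>amin\<close>; the other terms are monotone with nonnegative coefficients. The power of 2 is
  that of \<open>powr_strongly_monotone\<close> at \<open>p = \<alpha> (int N)\<close>, where
  \<open>p + 1 = s - 1\<close>.\<close>

lemma F_strongly_monotone:
  fixes y z :: "'a::real_inner"
  assumes a: "a \<in> coeff_box N amin amax"
  shows "amin * 2 powr (1 - s) * norm (y - z) powr s
    \<le> (F N \<alpha> a (norm y) *\<^sub>R y - F N \<alpha> a (norm z) *\<^sub>R z) \<bullet> (y - z)"
proof -
  let ?g = "\<lambda>i. (norm y powr \<alpha> i *\<^sub>R y - norm z powr \<alpha> i *\<^sub>R z) \<bullet> (y - z)"
  have aN: "0 \<le> \<alpha> (int N)" "amin \<le> a (int N)"
    using s_gt_2 s_eq a by (auto simp: coeff_box_def)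
  have "amin * 2 powr (1 - s) * norm (y - z) powr s = amin * (2 powr (- (\<alpha> (int N) + 1)) * norm (y - z) powr (\<alpha> (int N) + 2))"
    by (simp add: s_eq algebra_simps)
  also have "\<dots> \<le> a (int N) * ?g (int N)"
    using aN amin_pos by (intro mult_mono powr_strongly_monotone) auto
  also have "\<dots> \<le> (\<Sum>i\<in>{-1..int N}. a i * ?g i)"
    using coeff_box_bounds[OF a] alpha_bounds
    by (intro member_le_sum mult_nonneg_nonneg powr_monotone) (auto intro: less_imp_le)
  also have "\<dots> = (F N \<alpha> a (norm y) *\<^sub>R y - F N \<alpha> a (norm z) *\<^sub>R z) \<bullet> (y - z)"
    by (simp add: F_scaleR inner_sum_left inner_diff_left inner_diff_right sum_subtractf[symmetric]
        algebra_simps)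
  finally show ?thesis .
qed

lemma F_coercive:
  assumes "a \<in> coeff_box N amin amax"
  shows "amin * 2 powr (1 - s) * norm y powr s \<le> (F N \<alpha> a (norm y) *\<^sub>R y) \<bullet> y"
  using F_strongly_monotone[OF assms, of y 0] by simp

lemma F_diff_coeff:
  fixes z :: real
  assumes "0 \<le> z" "\<And>i. i \<in> {-1..int N} \<Longrightarrow> \<bar>a i - b i\<bar> \<le> d"
  shows "\<bar>F N \<alpha> a z - F N \<alpha> b z\<bar> * z \<le> (real N + 2) * d * (1 + z powr (s - 1))"
proof -
  have d: "0 \<le> d" using assms(2)[of 0] by simp
  have "\<bar>F N \<alpha> a z - F N \<alpha> b z\<bar> * z = \<bar>\<Sum>i\<in>{-1..int N}. (a i - b i) * (z powr \<alpha> i * z)\<bar>"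
    using assms(1) abs_mult_pos[of z "\<Sum>i\<in>{-1..int N}. (a i - b i) * z powr \<alpha> i"]
    by (simp add: F_def sum_subtractf[symmetric] left_diff_distrib sum_distrib_right mult.assoc)
  also have "\<dots> \<le> (\<Sum>i\<in>{-1..int N}. d * (1 + z powr (s - 1)))"
    using assms
    by (intro order_trans[OF sum_abs] sum_mono)
       (use d in \<open>auto simp: abs_mult intro!: mult_mono norm_powr_alpha_le\<close>)
  also have "\<dots> = (real N + 2) * d * (1 + z powr (s - 1))"
    by (simp add: algebra_simps)
  finally show ?thesis .
qed

text \<open>The comparison with the zero coefficient vector; \<open>real N + 2\<close> counts the
  indices from -1 to N.\<close>

lemma F_growth:
  fixes z :: real
  assumes "a \<in> coeff_box N amin amax" "0 \<le> z"
  shows "\<bar>F N \<alpha> a z\<bar> * z \<le> (real N + 2) * amax * (1 + z powr (s - 1))"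
  using F_diff_coeff[of z a "\<lambda>_. 0" amax] coeff_box_bounds[OF assms(1)] assms(2)
  by (simp add: F_def)

text \<open>With \<open>c = amin * 2 powr (1 - s)\<close>, the middle factor is the Young constant
  for absorbing into \<open>c / 2\<close> times the s-th power. The last two come from the index
  count and from \<open>one_plus_powr_conjugate_le\<close>, and the leading 2 from clearing
  \<open>c / 2\<close>.\<close>

definition diff_const :: real where
  "diff_const = 2 * (2 / (amin * 2 powr (1 - s))) powr (1 / (s - 1)) *
     ((real N + 2) powr (s / (s - 1)) * 2 powr (s / (s - 1)))"

text \<open>Changing the argument at fixed coefficients \<open>a\<close> gives the monotone part;
  changing the coefficients at the fixed argument \<open>z\<close> gives the error. This order makes
  the remainder depend on \<open>norm z\<close> alone.\<close>

lemma F_difference_estimate: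
  fixes y z :: "'a::real_inner"
  assumes a: "a \<in> coeff_box N amin amax"
    and d: "\<And>i. i \<in> {-1..int N} \<Longrightarrow> \<bar>a i - b i\<bar> \<le> d"
  shows "amin * 2 powr (1 - s) * norm (y - z) powr s
    \<le> 2 * ((F N \<alpha> a (norm y) *\<^sub>R y - F N \<alpha> b (norm z) *\<^sub>R z) \<bullet> (y - z))
      + diff_const * d powr (s / (s - 1)) * (1 + norm z powr s)"
proof -
  define c where "c = amin * 2 powr (1 - s)"
  define s' where "s' = s / (s - 1)"
  define K where "K = (2 / c) powr (1 / (s - 1))"
  have c: "0 < c" using amin_pos by (simp add: c_def)
  have d0: "0 \<le> d" using d[of 0] by simp
  have s: "1 < s" using s_gt_2 by simp
  let ?X = "(F N \<alpha> a (norm y) *\<^sub>R y - F N \<alpha> b (norm z) *\<^sub>R z) \<bullet> (y - z)"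
  let ?w = "norm (y - z)"
  let ?B = "(real N + 2) * d * (1 + norm z powr (s - 1))"
  have "?B powr s' = (real N + 2) powr s' * d powr s' * (1 + norm z powr (s - 1)) powr s'"
    using d0 by (simp add: powr_mult)
  also have "\<dots> \<le> (real N + 2) powr s' * d powr s' * (2 powr s' * (1 + norm z powr s))"
    using s by (intro mult_left_mono) (auto simp: s'_def intro: one_plus_powr_conjugate_le)
  finally have "K * ?B powr s' \<le> K * ((real N + 2) powr s' * d powr s' * (2 powr s' * (1 + norm z powr s)))"
    by (intro mult_left_mono) (auto simp: K_def)
  also have "\<dots> = diff_const * d powr s' * (1 + norm z powr s) / 2"
    by (simp add: diff_const_def K_def flip: c_def s'_def)
  finally have B: "K * ?B powr s' \<le> diff_const * d powr s' * (1 + norm z powr s) / 2" .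
  have "c * ?w powr s \<le> ?X - ((F N \<alpha> a (norm z) - F N \<alpha> b (norm z)) *\<^sub>R z) \<bullet> (y - z)"
    using F_strongly_monotone[OF a, of y z]
    by (simp add: c_def inner_diff_left scaleR_diff_left)
  also have "\<dots> \<le> ?X + norm ((F N \<alpha> a (norm z) - F N \<alpha> b (norm z)) *\<^sub>R z) * ?w"
    using Cauchy_Schwarz_ineq2[of "(F N \<alpha> a (norm z) - F N \<alpha> b (norm z)) *\<^sub>R z" "y - z"] by simp
  also have "\<dots> \<le> ?X + ?B * ?w"
    using F_diff_coeff[of "norm z" a b d] d by (simp add: mult_right_mono)
  also have "?B * ?w \<le> c / 2 * ?w powr s + K * ?B powr s'"
    using mult_le_absorb_powr[of "c / 2" s ?w ?B] c s d0
    by (simp add: K_def s'_def ac_simps)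
  finally show ?thesis
    using B by (simp flip: c_def s'_def)
qed

end


section \<open>The energy identity\<close>

text \<open>The square of the integral is a symmetric double integral, so the two triangles off the
  diagonal contribute equally. This replaces differentiating the square of a primitive of
  \<open>h\<close>.\<close>

lemma square_integral_eq_triangle:
  fixes h :: "real \<Rightarrow> real"
  assumes "sigma_finite_measure L" and id: "(\<lambda>x. x) \<in> borel_measurable L"
    and atomless: "\<And>x. AE y in L. y \<noteq> x" and h: "integrable L h"
  shows "integrable L (\<lambda>t. h t * (\<integral>r. indicator {..t} r * h r \<partial>L))"
    and "(\<integral>t. h t \<partial>L)\<^sup>2 = 2 * (\<integral>t. h t * (\<integral>r. indicator {..t} r * h r \<partial>L) \<partial>L)"
proof -
  interpret L: sigma_finite_measure L by fact
  interpret LL: pair_sigma_finite L L ..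
  note [measurable] = id
  have h_meas [measurable]: "h \<in> borel_measurable L"
    using h by simp
  have hh: "integrable (L \<Otimes>\<^sub>M L) (\<lambda>(t, r). h t * h r)"
    by (intro LL.Fubini_integrable)
       (auto simp: abs_mult intro!: integrable_mult_left integrable_mult_right integrable_abs h)
  have le: "integrable (L \<Otimes>\<^sub>M L) (\<lambda>(t, r). h t * (indicator {..t} r * h r))"
    by (rule Bochner_Integration.integrable_bound[OF hh])
       (measurable, auto simp: indicator_def)
  have gt: "integrable (L \<Otimes>\<^sub>M L) (\<lambda>(t, r). h t * (indicator {t<..} r * h r))"
    by (rule Bochner_Integration.integrable_bound[OF hh])
       (measurable, auto simp: indicator_def)
  have ind: "integrable L (\<lambda>r. indicator {..t} r * h r)" "integrable L (\<lambda>r. indicator {t<..} r * h r)" for t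
    by (auto intro!: Bochner_Integration.integrable_bound[OF h] simp: indicator_def)
  show 1: "integrable L (\<lambda>t. h t * (\<integral>r. indicator {..t} r * h r \<partial>L))"
    using LL.integrable_fst[OF le] by simp
  have 2: "integrable L (\<lambda>t. h t * (\<integral>r. indicator {t<..} r * h r \<partial>L))"
    using LL.integrable_fst[OF gt] by simp
  have "(\<integral>t. h t * (\<integral>r. indicator {t<..} r * h r \<partial>L) \<partial>L)
      = (\<integral>t. \<integral>r. h t * (indicator {t<..} r * h r) \<partial>L \<partial>L)"
    by simp
  also have "\<dots> = (\<integral>r. \<integral>t. h t * (indicator {t<..} r * h r) \<partial>L \<partial>L)"
    using LL.Fubini_integral[OF gt] by simp
  also have "\<dots> = (\<integral>r. \<integral>t. h r * (indicator {..r} t * h t) \<partial>L \<partial>L)"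
  proof (rule Bochner_Integration.integral_cong[OF refl])
    fix r
    \<comment> \<open>Renaming turns the strict triangle into the closed one; they differ only at
      \<open>t = r\<close>, which is null since \<open>L\<close> has no atoms.\<close>
    show "(\<integral>t. h t * (indicator {t<..} r * h r) \<partial>L) = (\<integral>t. h r * (indicator {..r} t * h t) \<partial>L)"
      using atomless[of r] by (intro integral_cong_AE) (measurable, auto simp: indicator_def)
  qed
  finally have swap: "(\<integral>t. h t * (\<integral>r. indicator {t<..} r * h r \<partial>L) \<partial>L)
      = (\<integral>t. h t * (\<integral>r. indicator {..t} r * h r \<partial>L) \<partial>L)"
    by simp
  have "(\<integral>r. h r \<partial>L) = (\<integral>r. indicator {..t} r * h r \<partial>L) + (\<integral>r. indicator {t<..} r * h r \<partial>L)" for t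
    by (subst Bochner_Integration.integral_add[OF ind, symmetric])
       (auto intro!: Bochner_Integration.integral_cong simp: indicator_def)
  then have "(\<integral>t. h t \<partial>L)\<^sup>2
      = (\<integral>t. h t * ((\<integral>r. indicator {..t} r * h r \<partial>L) + (\<integral>r. indicator {t<..} r * h r \<partial>L)) \<partial>L)"
    by (simp add: power2_eq_square flip: integral_mult_left_zero)
  also have "\<dots> = 2 * (\<integral>t. h t * (\<integral>r. indicator {..t} r * h r \<partial>L) \<partial>L)"
    using 1 2 swap by (simp add: distrib_left)
  finally show "(\<integral>t. h t \<partial>L)\<^sup>2 = 2 * (\<integral>t. h t * (\<integral>r. indicator {..t} r * h r \<partial>L) \<partial>L)" .
qed

text \<open>A form of Minkowski's integral inequality in which only finiteness is claimed; Cauchy--Schwarz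
  with the weight \<open>n + 1\<close> needs a single change of the order of integration.\<close>

lemma nn_integral_square_time_integral_finite:
  fixes g :: "'t \<Rightarrow> 'x \<Rightarrow> real"
  assumes "finite_measure L" "sigma_finite_measure M"
    and g [measurable]: "(\<lambda>(t, x). g t x) \<in> borel_measurable (L \<Otimes>\<^sub>M M)"
    and g2: "AE t in L. integrable M (\<lambda>x. (g t x)\<^sup>2)"
    and n: "integrable L (\<lambda>t. sqrt (\<integral>x. (g t x)\<^sup>2 \<partial>M))"
  shows "(\<integral>\<^sup>+x. (\<integral>\<^sup>+t. ennreal \<bar>g t x\<bar> \<partial>L)\<^sup>2 \<partial>M) < \<infinity>"
proof -
  interpret L: finite_measure L by fact
  interpret M: sigma_finite_measure M by fact
  interpret LM: pair_sigma_finite L M ..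
  define n where "n t = sqrt (\<integral>x. (g t x)\<^sup>2 \<partial>M)" for t
  have n0: "0 \<le> n t" for t by (simp add: n_def)
  have [measurable]: "n \<in> borel_measurable L"
    using n by (simp add: n_def[abs_def])
  \<comment> \<open>The added 1 keeps the weight away from 0, where dividing by \<open>n t\<close>
    would fail, and stays integrable because \<open>L\<close> is finite.\<close>
  have "integrable L (\<lambda>t. n t + 1)"
    using n by (simp add: n_def[abs_def])
  then have S: "(\<integral>\<^sup>+t. ennreal (n t + 1) \<partial>L) < \<infinity>"
    using n0 by (auto simp: integrable_iff_bounded)
  let ?S = "\<integral>\<^sup>+t. ennreal (n t + 1) \<partial>L"
  have "(\<integral>\<^sup>+x. (\<integral>\<^sup>+t. ennreal \<bar>g t x\<bar> \<partial>L)\<^sup>2 \<partial>M)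
      \<le> (\<integral>\<^sup>+x. ?S * (\<integral>\<^sup>+t. ennreal ((g t x)\<^sup>2 / (n t + 1)) \<partial>L) \<partial>M)"
  proof (rule nn_integral_mono)
    fix x assume [measurable]: "x \<in> space M"
    have "(\<integral>\<^sup>+t. ennreal \<bar>g t x\<bar> \<partial>L)
        = (\<integral>\<^sup>+t. ennreal (sqrt (n t + 1)) * ennreal (\<bar>g t x\<bar> / sqrt (n t + 1)) \<partial>L)"
      using n0 by (intro nn_integral_cong) (simp add: ennreal_mult[symmetric] add_nonneg_pos less_imp_neq[symmetric] add_nonneg_eq_0_iff)
    also have "\<dots>\<^sup>2 \<le> (\<integral>\<^sup>+t. ennreal (sqrt (n t + 1)) ^ 2 \<partial>L) * (\<integral>\<^sup>+t. ennreal (\<bar>g t x\<bar> / sqrt (n t + 1)) ^ 2 \<partial>L)"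
      by (rule Cauchy_Schwarz_nn_integral) measurable
    also have "\<dots> = ?S * (\<integral>\<^sup>+t. ennreal ((g t x)\<^sup>2 / (n t + 1)) \<partial>L)"
      using n0 by (simp add: ennreal_power power_divide)
    finally show "(\<integral>\<^sup>+t. ennreal \<bar>g t x\<bar> \<partial>L)\<^sup>2 \<le> ?S * (\<integral>\<^sup>+t. ennreal ((g t x)\<^sup>2 / (n t + 1)) \<partial>L)" .
  qed
  also have "\<dots> = ?S * (\<integral>\<^sup>+t. \<integral>\<^sup>+x. ennreal ((g t x)\<^sup>2 / (n t + 1)) \<partial>M \<partial>L)"
    by (subst nn_integral_cmult) (auto simp: LM.Fubini')
  also have "(\<integral>\<^sup>+t. \<integral>\<^sup>+x. ennreal ((g t x)\<^sup>2 / (n t + 1)) \<partial>M \<partial>L) \<le> ?S"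
  proof (rule nn_integral_mono_AE, use g2 in eventually_elim)
    fix t assume i: "integrable M (\<lambda>x. (g t x)\<^sup>2)"
    have "(\<integral>\<^sup>+x. ennreal ((g t x)\<^sup>2 / (n t + 1)) \<partial>M) = ennreal ((\<integral>x. (g t x)\<^sup>2 \<partial>M) / (n t + 1))"
      using i n0[of t] by (subst nn_integral_eq_integral) auto
    also have "(\<integral>x. (g t x)\<^sup>2 \<partial>M) = (n t)\<^sup>2"
      by (simp add: n_def)
    also have "(n t)\<^sup>2 / (n t + 1) \<le> n t + 1"
      using n0[of t] by (simp add: field_simps power2_eq_square)
    finally show "(\<integral>\<^sup>+x. ennreal ((g t x)\<^sup>2 / (n t + 1)) \<partial>M) \<le> ennreal (n t + 1)"
      by (simp add: ennreal_leI)
  qed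
  finally show ?thesis
    using S by (simp add: ennreal_mult_less_top mult_left_mono order_le_less_trans)
qed

text \<open>For almost every \<open>x\<close> the triangle identity in time gives the formula for
  \<open>(w t x)\<^sup>2\<close>; weighting by \<open>\<phi>\<close>, integrating in
  \<open>x\<close> and swapping the integrals gives the claim. The work lies in the integrability
  that permits the swap, since \<open>g\<close> is only integrable in time with values in
  L2.\<close>

lemma weighted_energy_identity:
  fixes w g :: "real \<Rightarrow> 'x \<Rightarrow> real" and u0 \<phi> :: "'x \<Rightarrow> real"
  assumes "finite_measure L" "sigma_finite_measure M"
    and id: "(\<lambda>x. x) \<in> borel_measurable L" and atomless: "\<And>x. AE y in L. y \<noteq> x"
    and T: "T \<in> space L" "\<And>t. t \<in> space L \<Longrightarrow> t \<le> T"
    and g [measurable]: "(\<lambda>(t, x). g t x) \<in> borel_measurable (L \<Otimes>\<^sub>M M)"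
    and w [measurable]: "(\<lambda>(t, x). w t x) \<in> borel_measurable (L \<Otimes>\<^sub>M M)"
    and g2: "AE t in L. integrable M (\<lambda>x. (g t x)\<^sup>2)"
    and n: "integrable L (\<lambda>t. sqrt (\<integral>x. (g t x)\<^sup>2 \<partial>M))"
    and u0 [measurable]: "u0 \<in> borel_measurable M" and u02: "integrable M (\<lambda>x. (u0 x)\<^sup>2)"
    and \<phi> [measurable]: "\<phi> \<in> borel_measurable M"
    and \<phi>_bounds: "\<And>x. x \<in> space M \<Longrightarrow> 0 \<le> \<phi> x \<and> \<phi> x \<le> B"
    and deriv: "\<And>t. t \<in> space L \<Longrightarrow> AE x in M. integrable L (\<lambda>r. indicator {..t} r * g r x) \<and>
          w t x = u0 x + (\<integral>r. indicator {..t} r * g r x \<partial>L)"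
  shows "\<And>t. integrable L (\<lambda>r. indicator {..t} r * (\<integral>x. \<phi> x * g r x * w r x \<partial>M))"
    and "\<And>t. t \<in> space L \<Longrightarrow> (\<integral>x. \<phi> x * (w t x)\<^sup>2 \<partial>M) = (\<integral>x. \<phi> x * (u0 x)\<^sup>2 \<partial>M)
           + 2 * (\<integral>r. indicator {..t} r * (\<integral>x. \<phi> x * g r x * w r x \<partial>M) \<partial>L)"
    and "\<exists>K. \<forall>t\<in>space L. (\<integral>x. \<phi> x * (w t x)\<^sup>2 \<partial>M) \<le> K"
proof -
  interpret L: finite_measure L by fact
  interpret M: sigma_finite_measure M by fact
  interpret LM: pair_sigma_finite L M ..
  note [measurable] = id
  \<comment> \<open>\<open>\<bar>u0 x\<bar> + H x\<close> dominates the time integral at every time,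
    and the time integral of \<open>\<bar>g t x\<bar>\<close> is \<open>H x\<close> itself. Square
    integrability of \<open>u0\<close> and \<open>H\<close> thus makes \<open>g * R\<close>
    integrable on the product.\<close>
  define H where "H x = (\<integral>\<^sup>+t. ennreal \<bar>g t x\<bar> \<partial>L)" for x
  have H_meas [measurable]: "H \<in> borel_measurable M"
    unfolding H_def[abs_def] by measurable
  have H2: "(\<integral>\<^sup>+x. (H x)\<^sup>2 \<partial>M) < \<infinity>"
    using nn_integral_square_time_integral_finite[OF assms(1,2) g g2 n] by (simp add: H_def)
  \<comment> \<open>The null set on which \<open>w t\<close> differs from its time integral may
    depend on \<open>t\<close>. \<open>R\<close> is the version given by the formula at every point,
    and it is jointly measurable.\<close>
  define R where "R t x = u0 x + (\<integral>r. indicator {..t} r * g r x \<partial>L)" for t x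
  have R_meas [measurable]: "(\<lambda>(t, x). R t x) \<in> borel_measurable (L \<Otimes>\<^sub>M M)"
  proof -
    have [measurable]: "(\<lambda>z. g (snd z) (snd (fst z))) \<in> borel_measurable ((L \<Otimes>\<^sub>M M) \<Otimes>\<^sub>M L)"
      using measurable_compose[OF _ g, of "\<lambda>z. (snd z, snd (fst z))"] by simp
    show ?thesis
      unfolding R_def[abs_def] indicator_def atMost_iff by measurable
  qed
  have R_le: "ennreal \<bar>R t x\<bar> \<le> ennreal \<bar>u0 x\<bar> + H x" for t x
  proof -
    \<comment> \<open>Where the slice is not integrable, the Bochner integral is 0 by convention, so
      the bound holds for every \<open>x\<close>.\<close>
    have "ennreal \<bar>\<integral>r. indicator {..t} r * g r x \<partial>L\<bar> \<le> (\<integral>\<^sup>+r. ennreal \<bar>indicator {..t} r * g r x\<bar> \<partial>L)"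
      using integral_norm_bound_ennreal[of L "\<lambda>r. indicator {..t} r * g r x"]
      by (cases "integrable L (\<lambda>r. indicator {..t} r * g r x)") (auto simp: not_integrable_integral_eq)
    also have "\<dots> \<le> H x"
      unfolding H_def by (intro nn_integral_mono ennreal_leI) (auto simp: indicator_def)
    finally have "ennreal \<bar>u0 x\<bar> + ennreal \<bar>\<integral>r. indicator {..t} r * g r x \<partial>L\<bar> \<le> ennreal \<bar>u0 x\<bar> + H x"
      by (intro add_left_mono)
    then show ?thesis
      by (rule order_trans[rotated]) (simp add: R_def ennreal_leI flip: ennreal_plus)
  qed
  have wR: "AE x in M. w t x = R t x" if "t \<in> space L" for t
    using deriv[OF that] by eventually_elim (simp add: R_def)
  have B0: "0 \<le> B" if "x \<in> space M" for x
    using \<phi>_bounds[OF that] by simp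
  have u0_nn: "(\<integral>\<^sup>+x. ennreal ((u0 x)\<^sup>2) \<partial>M) < \<infinity>"
    using u02 by (auto simp: integrable_iff_bounded)

  have int: "integrable (L \<Otimes>\<^sub>M M) (\<lambda>(r, x). indicator {..t} r * (\<phi> x * g r x * R r x))" for t
  proof (rule integrableI_bounded)
    have "(\<integral>\<^sup>+z. ennreal (norm (case z of (r, x) \<Rightarrow> indicator {..t} r * (\<phi> x * g r x * R r x))) \<partial>(L \<Otimes>\<^sub>M M))
      = (\<integral>\<^sup>+x. \<integral>\<^sup>+r. ennreal (norm (indicator {..t} r * (\<phi> x * g r x * R r x))) \<partial>L \<partial>M)"
      by (subst LM.nn_integral_snd[symmetric]) (auto simp: case_prod_beta')
    also have "\<dots> \<le> (\<integral>\<^sup>+x. ennreal B * (ennreal ((u0 x)\<^sup>2) + 2 * (H x)\<^sup>2) \<partial>M)"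
    proof (rule nn_integral_mono)
      fix x assume x [measurable]: "x \<in> space M"
      let ?c = "ennreal B * (ennreal \<bar>u0 x\<bar> + H x)"
      have "(\<integral>\<^sup>+r. ennreal (norm (indicator {..t} r * (\<phi> x * g r x * R r x))) \<partial>L)
          \<le> (\<integral>\<^sup>+r. ?c * ennreal \<bar>g r x\<bar> \<partial>L)"
      proof (rule nn_integral_mono)
        fix r
        have "ennreal (norm (indicator {..t} r * (\<phi> x * g r x * R r x))) \<le> ennreal (B * (\<bar>g r x\<bar> * \<bar>R r x\<bar>))"
          using \<phi>_bounds[OF x] B0[OF x]
          by (intro ennreal_leI) (auto simp: indicator_def abs_mult mult.assoc intro: mult_right_mono)
        also have "\<dots> = ennreal B * ennreal \<bar>R r x\<bar> * ennreal \<bar>g r x\<bar>"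
          using B0[OF x] by (simp add: ennreal_mult ac_simps)
        also have "\<dots> \<le> ?c * ennreal \<bar>g r x\<bar>"
          by (intro mult_right_mono mult_left_mono R_le) auto
        finally show "ennreal (norm (indicator {..t} r * (\<phi> x * g r x * R r x))) \<le> ?c * ennreal \<bar>g r x\<bar>" .
      qed
      also have "\<dots> = ennreal B * (ennreal \<bar>u0 x\<bar> * H x + (H x)\<^sup>2)"
        by (subst nn_integral_cmult) (auto simp: H_def distrib_right distrib_left power2_eq_square mult.assoc)
      also have "\<dots> \<le> ennreal B * (ennreal ((u0 x)\<^sup>2) + 2 * (H x)\<^sup>2)"
      proof (rule mult_left_mono)
        have "ennreal \<bar>u0 x\<bar> * H x \<le> ennreal ((u0 x)\<^sup>2) + (H x)\<^sup>2"
        proof (cases "H x")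
          case (real y)
          have "\<bar>u0 x\<bar> * y \<le> (u0 x)\<^sup>2 + y\<^sup>2"
            using sum_squares_bound[of "\<bar>u0 x\<bar>" y] mult_nonneg_nonneg[OF abs_ge_zero[of "u0 x"] real(1)]
            by (simp only: mult.assoc power2_abs)
          then show ?thesis
            using real by (simp add: ennreal_mult[symmetric] ennreal_power ennreal_leI flip: ennreal_plus)
        qed (simp add: power2_eq_square ennreal_mult_top)
        then show "ennreal \<bar>u0 x\<bar> * H x + (H x)\<^sup>2 \<le> ennreal ((u0 x)\<^sup>2) + 2 * (H x)\<^sup>2"
          by (simp add: mult_2 add_mono add.assoc[symmetric])
      qed simp
      finally show "(\<integral>\<^sup>+r. ennreal (norm (indicator {..t} r * (\<phi> x * g r x * R r x))) \<partial>L)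
          \<le> ennreal B * (ennreal ((u0 x)\<^sup>2) + 2 * (H x)\<^sup>2)" .
    qed
    also have "\<dots> = ennreal B * ((\<integral>\<^sup>+x. ennreal ((u0 x)\<^sup>2) \<partial>M) + 2 * (\<integral>\<^sup>+x. (H x)\<^sup>2 \<partial>M))"
      by (simp add: nn_integral_cmult nn_integral_add)
    also have "\<dots> < \<infinity>"
      using H2 u0_nn by (simp add: ennreal_mult_less_top)
    finally show "(\<integral>\<^sup>+z. ennreal (norm (case z of (r, x) \<Rightarrow> indicator {..t} r * (\<phi> x * g r x * R r x))) \<partial>(L \<Otimes>\<^sub>M M)) < \<infinity>" .
  qed measurable

  have inner: "(\<integral>x. \<phi> x * g r x * R r x \<partial>M) = (\<integral>x. \<phi> x * g r x * w r x \<partial>M)" if r [measurable]: "r \<in> space L" for r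
    using wR[OF r] by (intro integral_cong_AE) auto
  have phi_u0: "integrable M (\<lambda>x. \<phi> x * (u0 x)\<^sup>2)"
    using \<phi>_bounds B0
    by (intro Bochner_Integration.integrable_bound[OF integrable_mult_right[OF u02, of B]] AE_I2)
       (auto simp: abs_mult intro!: mult_right_mono)

  have cong: "(\<integral>x. indicator {..t} r * (\<phi> x * g r x * R r x) \<partial>M)
      = indicator {..t} r * (\<integral>x. \<phi> x * g r x * w r x \<partial>M)" if "r \<in> space L" for r t
    using inner[OF that] by simp
  show X_int: "integrable L (\<lambda>r. indicator {..t} r * (\<integral>x. \<phi> x * g r x * w r x \<partial>M))" for t
    by (rule iffD1[OF Bochner_Integration.integrable_cong LM.integrable_fst[OF int[of t]]])
       (auto simp: cong[symmetric])

  show energy: "(\<integral>x. \<phi> x * (w t x)\<^sup>2 \<partial>M) = (\<integral>x. \<phi> x * (u0 x)\<^sup>2 \<partial>M)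
           + 2 * (\<integral>r. indicator {..t} r * (\<integral>x. \<phi> x * g r x * w r x \<partial>M) \<partial>L)"
    if t [measurable]: "t \<in> space L" for t
  proof -
    \<comment> \<open>The hypothesis at the final time \<open>T\<close> gives integrability of the
      whole slice for almost every \<open>x\<close>; the triangle identity is then applied to the
      slice cut off at \<open>t\<close>.\<close>
    have "AE x in M. \<phi> x * (w t x)\<^sup>2
        = \<phi> x * (u0 x)\<^sup>2 + 2 * (\<integral>r. indicator {..t} r * (\<phi> x * g r x * R r x) \<partial>L)"
      using deriv[OF T(1)] wR[OF t]
    proof eventually_elim
      case (elim x)
      have "integrable L (\<lambda>r. indicator {..T} r * g r x) \<longleftrightarrow> integrable L (\<lambda>r. g r x)"
        using T(2) by (intro Bochner_Integration.integrable_cong) (auto simp: indicator_def)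
      then have gi: "integrable L (\<lambda>r. g r x)" using elim by simp
      define h where "h r = indicator {..t} r * g r x" for r
      have hi: "integrable L h"
        unfolding h_def[abs_def] by (rule Bochner_Integration.integrable_bound[OF gi])
          (use gi in \<open>auto simp: indicator_def\<close>)
      note tri = square_integral_eq_triangle[OF L.sigma_finite_measure_axioms id atomless hi]
      \<comment> \<open>For \<open>r \<le> t\<close> the cutoff at \<open>t\<close> is invisible on
        \<open>{..r}\<close>, so the inner integral rebuilds \<open>R r x\<close>; for larger
        \<open>r\<close> both sides vanish.\<close>
      have hr: "h r * (u0 x + (\<integral>q. indicator {..r} q * h q \<partial>L)) = indicator {..t} r * (g r x * R r x)" for r
      proof (cases "r \<le> t")
        case True
        then have "(\<lambda>q. indicator {..r} q * h q) = (\<lambda>q. indicator {..r} q * g q x)"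
          by (auto simp: h_def indicator_def)
        then show ?thesis using True by (simp add: h_def R_def)
      qed (simp add: h_def)
      have "(w t x)\<^sup>2 = (u0 x + (\<integral>r. h r \<partial>L))\<^sup>2"
        using elim by (simp add: R_def h_def)
      also have "\<dots> = (u0 x)\<^sup>2 + 2 * (u0 x * (\<integral>r. h r \<partial>L)) + (\<integral>r. h r \<partial>L)\<^sup>2"
        by (simp add: power2_sum algebra_simps)
      also have "\<dots> = (u0 x)\<^sup>2 + 2 * ((\<integral>r. h r * u0 x \<partial>L) + (\<integral>r. h r * (\<integral>q. indicator {..r} q * h q \<partial>L) \<partial>L))"
        by (simp add: tri(2))
      also have "\<dots> = (u0 x)\<^sup>2 + 2 * (\<integral>r. h r * (u0 x + (\<integral>q. indicator {..r} q * h q \<partial>L)) \<partial>L)"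
        using tri(1) hi by (simp add: distrib_left)
      finally have "\<phi> x * (w t x)\<^sup>2 = \<phi> x * (u0 x)\<^sup>2 + 2 * (\<phi> x * (\<integral>r. indicator {..t} r * (g r x * R r x) \<partial>L))"
        unfolding hr by (simp add: algebra_simps)
      then show ?case
        by (simp add: ac_simps flip: integral_mult_right_zero)
    qed
    then have "(\<integral>x. \<phi> x * (w t x)\<^sup>2 \<partial>M)
        = (\<integral>x. \<phi> x * (u0 x)\<^sup>2 + 2 * (\<integral>r. indicator {..t} r * (\<phi> x * g r x * R r x) \<partial>L) \<partial>M)"
      by (intro integral_cong_AE) auto
    also have "\<dots> = (\<integral>x. \<phi> x * (u0 x)\<^sup>2 \<partial>M) + 2 * (\<integral>x. \<integral>r. indicator {..t} r * (\<phi> x * g r x * R r x) \<partial>L \<partial>M)"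
      using phi_u0 LM.integrable_snd[OF int[of t]] by simp
    also have "(\<integral>x. \<integral>r. indicator {..t} r * (\<phi> x * g r x * R r x) \<partial>L \<partial>M)
        = (\<integral>r. \<integral>x. indicator {..t} r * (\<phi> x * g r x * R r x) \<partial>M \<partial>L)"
      using LM.Fubini_integral[OF int[of t]] .
    also have "\<dots> = (\<integral>r. indicator {..t} r * (\<integral>x. \<phi> x * g r x * w r x \<partial>M) \<partial>L)"
      by (intro Bochner_Integration.integral_cong cong) auto
    finally show "(\<integral>x. \<phi> x * (w t x)\<^sup>2 \<partial>M) = (\<integral>x. \<phi> x * (u0 x)\<^sup>2 \<partial>M)
             + 2 * (\<integral>r. indicator {..t} r * (\<integral>x. \<phi> x * g r x * w r x \<partial>M) \<partial>L)" .
  qed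

  let ?X = "\<lambda>r. \<integral>x. \<phi> x * g r x * w r x \<partial>M"
  have "integrable L ?X"
    using X_int[of T] T(2) by (subst Bochner_Integration.integrable_cong) (auto simp: indicator_def)
  then have "(\<integral>r. indicator {..t} r * ?X r \<partial>L) \<le> (\<integral>r. \<bar>?X r\<bar> \<partial>L)" for t
    by (intro integral_mono X_int) (auto simp: indicator_def)
  then show "\<exists>K. \<forall>t\<in>space L. (\<integral>x. \<phi> x * (w t x)\<^sup>2 \<partial>M) \<le> K"
    by (intro exI[of _ "(\<integral>x. \<phi> x * (u0 x)\<^sup>2 \<partial>M) + 2 * (\<integral>r. \<bar>?X r\<bar> \<partial>L)"]) (simp add: energy)
qed


section \<open>Lebesgue spaces on the space-time cylinder\<close>

lemma mem_Lp_space_2_iff: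
  fixes u :: "'a \<Rightarrow> real"
  shows "u \<in> Lp_space 2 M \<longleftrightarrow> u \<in> borel_measurable M \<and> integrable M (\<lambda>x. (u x)\<^sup>2)"
  by (simp add: Lp_space_def)

lemma Lp_norm_2_eq:
  fixes u :: "'a \<Rightarrow> real"
  shows "Lp_norm 2 M u = sqrt (\<integral>x. (u x)\<^sup>2 \<partial>M)"
  by (simp add: Lp_norm_def powr_half_sqrt)

lemma Lp_space_diff_2:
  fixes u v :: "'a \<Rightarrow> real"
  assumes "u \<in> Lp_space 2 M" "v \<in> Lp_space 2 M"
  shows "(\<lambda>x. u x - v x) \<in> Lp_space 2 M"
    and "(\<integral>x. (u x - v x)\<^sup>2 \<partial>M) \<le> 2 * (\<integral>x. (u x)\<^sup>2 \<partial>M) + 2 * (\<integral>x. (v x)\<^sup>2 \<partial>M)"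
proof -
  have [measurable]: "u \<in> borel_measurable M" "v \<in> borel_measurable M"
    and i: "integrable M (\<lambda>x. 2 * (u x)\<^sup>2 + 2 * (v x)\<^sup>2)"
      "integrable M (\<lambda>x. (u x)\<^sup>2)" "integrable M (\<lambda>x. (v x)\<^sup>2)"
    using assms by (auto simp: mem_Lp_space_2_iff)
  have le: "(a - b)\<^sup>2 \<le> 2 * a\<^sup>2 + 2 * b\<^sup>2" for a b :: real
    using zero_le_power2[of "a + b"] by (simp add: power2_sum power2_diff)
  have j: "integrable M (\<lambda>x. (u x - v x)\<^sup>2)"
    by (rule Bochner_Integration.integrable_bound[OF i(1)]) (auto intro!: AE_I2 simp: le)
  then show "(\<lambda>x. u x - v x) \<in> Lp_space 2 M"
    by (simp add: mem_Lp_space_2_iff)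
  have "(\<integral>x. (u x - v x)\<^sup>2 \<partial>M) \<le> (\<integral>x. 2 * (u x)\<^sup>2 + 2 * (v x)\<^sup>2 \<partial>M)"
    by (rule integral_mono[OF j i(1) le])
  then show "(\<integral>x. (u x - v x)\<^sup>2 \<partial>M) \<le> 2 * (\<integral>x. (u x)\<^sup>2 \<partial>M) + 2 * (\<integral>x. (v x)\<^sup>2 \<partial>M)"
    using i by simp
qed

lemma integrable_mult_Lp_2:
  fixes u v :: "'a \<Rightarrow> real"
  assumes "u \<in> Lp_space 2 M" "v \<in> Lp_space 2 M"
  shows "integrable M (\<lambda>x. u x * v x)"
proof -
  have [measurable]: "u \<in> borel_measurable M" "v \<in> borel_measurable M"
    and i: "integrable M (\<lambda>x. (u x)\<^sup>2 + (v x)\<^sup>2)"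
    using assms by (auto simp: mem_Lp_space_2_iff)
  have "\<bar>a * b\<bar> \<le> a\<^sup>2 + b\<^sup>2" for a b :: real
    using sum_squares_bound[of "\<bar>a\<bar>" "\<bar>b\<bar>"] mult_nonneg_nonneg[OF abs_ge_zero abs_ge_zero, of a b]
    by (simp only: mult.assoc power2_abs abs_mult)
  then show ?thesis
    by (intro Bochner_Integration.integrable_bound[OF i]) (auto intro!: AE_I2)
qed

lemma mult_bounded_Lp_2:
  fixes u b :: "'a \<Rightarrow> real"
  assumes u: "u \<in> Lp_space 2 M" and b: "b \<in> borel_measurable M" "\<And>x. x \<in> space M \<Longrightarrow> \<bar>b x\<bar> \<le> B"
  shows "(\<lambda>x. b x * u x) \<in> Lp_space 2 M"
proof -
  have [measurable]: "u \<in> borel_measurable M" and i: "integrable M (\<lambda>x. B\<^sup>2 * (u x)\<^sup>2)"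
    using u by (auto simp: mem_Lp_space_2_iff)
  note [measurable] = b(1)
  have "(b x * u x)\<^sup>2 \<le> B\<^sup>2 * (u x)\<^sup>2" if "x \<in> space M" for x
    using power_mono[OF b(2)[OF that], of 2] by (simp add: power_mult_distrib mult_right_mono)
  then have "integrable M (\<lambda>x. (b x * u x)\<^sup>2)"
    by (intro Bochner_Integration.integrable_bound[OF i] AE_I2) (auto simp: abs_mult)
  then show ?thesis
    by (simp add: mem_Lp_space_2_iff)
qed

text \<open>\<open>0 \<le> B\<close> covers the degenerate cases: an essential supremum of infinity
  (non-measurable \<open>u\<close>) or of minus infinity (null measure) becomes 0 under
  \<open>real_of_ereal\<close>.\<close>

lemma Linf_norm_le:
  assumes "AE x in M. norm (u x) \<le> B" "0 \<le> B"
  shows "Linf_norm M u \<le> B"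
proof (cases "(\<lambda>x. ereal (norm (u x))) \<in> borel_measurable M")
  case True
  then have "esssup M (\<lambda>x. ereal (norm (u x))) \<le> ereal B"
    using assms by (intro esssup_I) auto
  then show ?thesis
    using assms(2) by (cases "esssup M (\<lambda>x. ereal (norm (u x)))") (auto simp: Linf_norm_def)
qed (use assms(2) in \<open>simp add: Linf_norm_def esssup_non_measurable top_ereal_def\<close>)

text \<open>The bound \<open>B\<close> does not enter the conclusion; it excludes an infinite
  essential supremum, which \<open>real_of_ereal\<close> would turn into 0.\<close>

lemma AE_le_Linf_norm:
  assumes u: "(\<lambda>x. norm (u x)) \<in> borel_measurable M" and B: "AE x in M. norm (u x) \<le> B"
  shows "AE x in M. norm (u x) \<le> Linf_norm M u"
proof -
  have "esssup M (\<lambda>x. ereal (norm (u x))) \<le> ereal B"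
    using assms by (intro esssup_I) auto
  then show ?thesis
    using esssup_AE[of "\<lambda>x. ereal (norm (u x))" M]
    by (cases "esssup M (\<lambda>x. ereal (norm (u x)))") (auto simp: Linf_norm_def)
qed

lemma Lp_norm_nonneg: "0 \<le> Lp_norm p M u"
  by (simp add: Lp_norm_def)

lemma Lp_norm_powr:
  assumes "p \<noteq> 0"
  shows "Lp_norm p M u powr p = (\<integral>x. norm (u x) powr p \<partial>M)"
  using assms by (simp add: Lp_norm_def powr_powr)

locale space_time_domain =
  fixes \<Omega> :: "(real^'d) set" and T :: real
  assumes open_domain: "open \<Omega>" and bounded_domain: "bounded \<Omega>" and T_pos: "0 < T"
begin

abbreviation L where "L \<equiv> lebesgue_on {0..T}"
abbreviation M where "M \<equiv> lebesgue_on \<Omega>"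

sublocale L: finite_measure L
  by (rule finite_measure_lebesgue_on) simp

sublocale M: finite_measure M
  by (intro finite_measure_lebesgue_on lmeasurable_open bounded_domain open_domain)

sublocale LM: pair_sigma_finite L M ..

lemma space_L [simp]: "space L = {0..T}" and space_M [simp]: "space M = \<Omega>"
  by (auto simp: space_restrict_space)

lemma L_atomless: "AE y in L. y \<noteq> x"
  by (rule AE_restrict_space_iff[THEN iffD2])
     (auto intro!: AE_I[where N = "{x}"] simp: emeasure_completion)

text \<open>Writes integrals over all the intervals \<open>{0..t}\<close> against the single measure
  \<open>L\<close>, so that the energy identity can work on one product space.\<close>

lemma integral_subinterval:
  assumes "t \<in> {0..T}"
  shows "integrable (lebesgue_on {0..t}) h \<longleftrightarrow> integrable L (\<lambda>r. indicator {..t} r * (h r :: real))"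
    and "(\<integral>r. h r \<partial>lebesgue_on {0..t}) = (\<integral>r. indicator {..t} r * h r \<partial>L)"
proof -
  have eq: "indicator {0..t} r * h r = indicator {0..T} r * (indicator {..t} r * h r)" for r
    using assms by (auto simp: indicator_def)
  show "integrable (lebesgue_on {0..t}) h \<longleftrightarrow> integrable L (\<lambda>r. indicator {..t} r * h r)"
    by (simp add: integrable_restrict_space eq)
  show "(\<integral>r. h r \<partial>lebesgue_on {0..t}) = (\<integral>r. indicator {..t} r * h r \<partial>L)"
    by (simp add: integral_restrict_space eq)
qed

lemma has_time_derivative_diff:
  assumes "has_time_derivative T \<Omega> u u'" "has_time_derivative T \<Omega> v v'"
  shows "has_time_derivative T \<Omega> (\<lambda>t x. u t x - v t x) (\<lambda>t x. u' t x - v' t x)"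
proof -
  have "AE x in M. integrable (lebesgue_on {0..t}) (\<lambda>\<tau>. u' \<tau> x - v' \<tau> x) \<and>
      u t x - v t x = u 0 x - v 0 x + (\<integral>\<tau>. u' \<tau> x - v' \<tau> x \<partial>lebesgue_on {0..t})"
    if "t \<in> {0..T}" for t
  proof -
    have "AE x in M. integrable (lebesgue_on {0..t}) (\<lambda>\<tau>. u' \<tau> x) \<and>
        u t x = u 0 x + (\<integral>\<tau>. u' \<tau> x \<partial>lebesgue_on {0..t})"
      "AE x in M. integrable (lebesgue_on {0..t}) (\<lambda>\<tau>. v' \<tau> x) \<and>
        v t x = v 0 x + (\<integral>\<tau>. v' \<tau> x \<partial>lebesgue_on {0..t})"
      using assms that by (auto simp: has_time_derivative_def)
    then show ?thesis by eventually_elim simp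
  qed
  then show ?thesis
    using assms by (auto simp: has_time_derivative_def case_prod_beta')
qed

lemma Lp_Lq_space_1_2_diff:
  fixes u v :: "real \<Rightarrow> real^'d \<Rightarrow> real"
  assumes u: "u \<in> Lp_Lq_space 1 2 T \<Omega>" and v: "v \<in> Lp_Lq_space 1 2 T \<Omega>"
  shows "(\<lambda>t x. u t x - v t x) \<in> Lp_Lq_space 1 2 T \<Omega>"
proof -
  have [measurable]: "(\<lambda>(t, x). u t x) \<in> borel_measurable (L \<Otimes>\<^sub>M M)"
    "(\<lambda>(t, x). v t x) \<in> borel_measurable (L \<Otimes>\<^sub>M M)"
    using u v by (auto simp: Lp_Lq_space_def space_time_def)
  have AE: "AE t in L. u t \<in> Lp_space 2 M" "AE t in L. v t \<in> Lp_space 2 M"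
    using u v by (auto simp: Lp_Lq_space_def)
  have int: "integrable L (\<lambda>t. 2 * Lp_norm 2 M (u t) + 2 * Lp_norm 2 M (v t))"
    using u v by (simp add: Lp_Lq_space_def Lp_space_def Lp_norm_nonneg)
  have le: "2 * p + 2 * q \<le> (2 * sqrt p + 2 * sqrt q)\<^sup>2" if "0 \<le> p" "0 \<le> q" for p q :: real
  proof -
    have "0 \<le> sqrt p * sqrt q" using that by simp
    then show ?thesis
      using that by (simp del: real_sqrt_mult zero_le_mult_iff add: power2_sum power_mult_distrib)
  qed
  have "AE t in L. norm (Lp_norm 2 M (\<lambda>x. u t x - v t x)) \<le> norm (2 * Lp_norm 2 M (u t) + 2 * Lp_norm 2 M (v t))"
    using AE
  proof eventually_elim
    case (elim t)
    have "(\<integral>x. (u t x - v t x)\<^sup>2 \<partial>M) \<le> (2 * sqrt (\<integral>x. (u t x)\<^sup>2 \<partial>M) + 2 * sqrt (\<integral>x. (v t x)\<^sup>2 \<partial>M))\<^sup>2"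
      by (rule order_trans[OF Lp_space_diff_2(2)[OF elim] le]) auto
    then show ?case
      by (simp add: Lp_norm_2_eq real_le_lsqrt)
  qed
  then have "integrable L (\<lambda>t. Lp_norm 2 M (\<lambda>x. u t x - v t x))"
    by (intro Bochner_Integration.integrable_bound[OF int]) (simp add: Lp_norm_2_eq)
  moreover have "AE t in L. (\<lambda>x. u t x - v t x) \<in> Lp_space 2 M"
    using AE by eventually_elim (rule Lp_space_diff_2)
  ultimately show ?thesis
    by (simp add: Lp_Lq_space_def space_time_def Lp_space_def Lp_norm_nonneg)
qed

lemma energy_identity:
  assumes u: "has_time_derivative T \<Omega> u u'" "u' \<in> Lp_Lq_space 1 2 T \<Omega>" "u 0 \<in> Lp_space 2 M"
    and \<phi>: "\<phi> \<in> borel_measurable M" "\<forall>x\<in>\<Omega>. 0 \<le> \<phi> x \<and> \<phi> x \<le> B"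
  shows "\<And>t. integrable L (\<lambda>r. indicator {..t} r * (\<integral>x. \<phi> x * u' r x * u r x \<partial>M))"
    and "\<And>t. t \<in> {0..T} \<Longrightarrow> (\<integral>x. \<phi> x * (u t x)\<^sup>2 \<partial>M) = (\<integral>x. \<phi> x * (u 0 x)\<^sup>2 \<partial>M)
           + 2 * (\<integral>r. indicator {..t} r * (\<integral>x. \<phi> x * u' r x * u r x \<partial>M) \<partial>L)"
    and "\<exists>K. \<forall>t\<in>{0..T}. (\<integral>x. \<phi> x * (u t x)\<^sup>2 \<partial>M) \<le> K"
proof -
  have 1: "(\<lambda>x. x) \<in> borel_measurable L"
    by (rule measurable_restrict_space1) (simp add: id_borel_measurable_lebesgue[unfolded id_def])
  have 2: "(\<lambda>(t, x). u' t x) \<in> borel_measurable (L \<Otimes>\<^sub>M M)" "(\<lambda>(t, x). u t x) \<in> borel_measurable (L \<Otimes>\<^sub>M M)"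
    using u by (auto simp: has_time_derivative_def space_time_def)
  have 3: "AE t in L. integrable M (\<lambda>x. (u' t x)\<^sup>2)"
    using u(2) by (simp add: Lp_Lq_space_def mem_Lp_space_2_iff)
  have 4: "integrable L (\<lambda>t. sqrt (\<integral>x. (u' t x)\<^sup>2 \<partial>M))"
    using u(2) by (simp add: Lp_Lq_space_def Lp_norm_2_eq Lp_space_def)
  have 5: "AE x in M. integrable L (\<lambda>r. indicator {..t} r * u' r x) \<and>
      u t x = u 0 x + (\<integral>r. indicator {..t} r * u' r x \<partial>L)" if "t \<in> space L" for t
  proof -
    have t: "t \<in> {0..T}" using that by simp
    have "\<forall>t\<in>{0..T}. AE x in M. integrable (lebesgue_on {0..t}) (\<lambda>\<tau>. u' \<tau> x) \<and>
        u t x = u 0 x + (\<integral>\<tau>. u' \<tau> x \<partial>lebesgue_on {0..t})"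
      using u(1) unfolding has_time_derivative_def by (elim conjE)
    from bspec[OF this t] show ?thesis
      unfolding integral_subinterval[OF t] .
  qed
  have 6: "T \<in> space L" "\<And>t. t \<in> space L \<Longrightarrow> t \<le> T"
    using T_pos by auto
  have 7: "u 0 \<in> borel_measurable M" "integrable M (\<lambda>x. (u 0 x)\<^sup>2)"
    using u(3) by (auto simp: mem_Lp_space_2_iff)
  have 8: "\<And>x. x \<in> space M \<Longrightarrow> 0 \<le> \<phi> x \<and> \<phi> x \<le> B"
    using \<phi>(2) by simp
  note energy = weighted_energy_identity[OF L.finite_measure_axioms M.sigma_finite_measure_axioms 1
      L_atomless 6 2 3 4 7 \<phi>(1) 8 5, unfolded space_L]
  show "integrable L (\<lambda>r. indicator {..t} r * (\<integral>x. \<phi> x * u' r x * u r x \<partial>M))" for t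
    by (rule energy(1))
  show "(\<integral>x. \<phi> x * (u t x)\<^sup>2 \<partial>M) = (\<integral>x. \<phi> x * (u 0 x)\<^sup>2 \<partial>M)
      + 2 * (\<integral>r. indicator {..t} r * (\<integral>x. \<phi> x * u' r x * u r x \<partial>M) \<partial>L)"
    if "t \<in> {0..T}" for t
    by (rule energy(2)) (use that in simp_all)
  show "\<exists>K. \<forall>t\<in>{0..T}. (\<integral>x. \<phi> x * (u t x)\<^sup>2 \<partial>M) \<le> K"
    by (rule energy(3))
qed

text \<open>\<open>grad\<close> and \<open>dt\<close> are given by description operators; uniqueness
  of derivatives identifies them on \<open>\<Omega>\<close> with the fields supplied by
  \<open>C12\<close>. Continuity of these on the compact closed cylinder yields one bound for all
  times.\<close>

lemma C12_derivatives:
  assumes "C12 \<Omega> T u"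
  obtains K where "\<And>t. t \<in> {0..T} \<Longrightarrow> grad (u t) \<in> borel_measurable M"
    and "\<And>t. t \<in> {0..T} \<Longrightarrow> dt T u t \<in> borel_measurable M"
    and "\<And>t x. t \<in> {0..T} \<Longrightarrow> x \<in> \<Omega> \<Longrightarrow> norm (grad (u t) x) \<le> K"
    and "\<And>t x. t \<in> {0..T} \<Longrightarrow> x \<in> \<Omega> \<Longrightarrow> \<bar>dt T u t x\<bar> \<le> K"
proof -
  obtain G u' where G: "continuous_on ({0..T} \<times> closure \<Omega>) (\<lambda>(t, x). G t x :: real^'d)"
    and u': "continuous_on ({0..T} \<times> closure \<Omega>) (\<lambda>(t, x). u' t x)"
    and d: "\<And>t x. t \<in> {0..T} \<Longrightarrow> x \<in> \<Omega> \<Longrightarrow> (GDERIV (u t) x :> G t x) \<and>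
           ((\<lambda>\<tau>. u \<tau> x) has_real_derivative u' t x) (at t within {0..T})"
    using assms unfolding C12_def by blast
  have grad: "grad (u t) x = G t x" if "t \<in> {0..T}" "x \<in> \<Omega>" for t x
    unfolding grad_def
  proof (rule the_equality)
    fix D assume "GDERIV (u t) x :> D"
    then have "(\<lambda>h. h \<bullet> D) = (\<lambda>h. h \<bullet> G t x)"
      using d[OF that] unfolding gderiv_def by (blast intro: has_derivative_unique)
    then show "D = G t x"
      by (metis vector_eq_ldot)
  qed (use d that in blast)
  have dt: "dt T u t x = u' t x" if "t \<in> {0..T}" "x \<in> \<Omega>" for t x
    unfolding dt_def
    using d[OF that] that T_pos vector_derivative_within_closed_interval[of 0 T t "\<lambda>\<tau>. u \<tau> x" "u' t x"]
    by (auto simp: has_real_derivative_iff_has_vector_derivative)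
  have comp: "compact ({0..T} \<times> closure \<Omega>)"
    using bounded_domain by (intro compact_Times) (auto simp: compact_closure)
  obtain K1 where K1: "\<And>z. z \<in> {0..T} \<times> closure \<Omega> \<Longrightarrow> norm (case z of (t, x) \<Rightarrow> G t x) \<le> K1"
    using compact_imp_bounded[OF compact_continuous_image[OF G comp]] by (auto simp: bounded_iff)
  obtain K2 where K2: "\<And>z. z \<in> {0..T} \<times> closure \<Omega> \<Longrightarrow> norm (case z of (t, x) \<Rightarrow> u' t x) \<le> K2"
    using compact_imp_bounded[OF compact_continuous_image[OF u' comp]] by (auto simp: bounded_iff)
  have sub: "\<Omega> \<subseteq> closure \<Omega>" by (rule closure_subset)
  show thesis
  proof
    fix t assume t: "t \<in> {0..T}"
    have "continuous_on \<Omega> (\<lambda>x. (case (t, x) of (t, x) \<Rightarrow> G t x))"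
      by (rule continuous_on_compose2[OF G]) (use t sub in \<open>auto intro!: continuous_intros\<close>)
    then have "G t \<in> borel_measurable M"
      by (simp add: continuous_imp_measurable_on_sets_lebesgue open_domain)
    then show "grad (u t) \<in> borel_measurable M"
      by (rule measurable_cong[THEN iffD1, rotated]) (use t grad in auto)
    have "continuous_on \<Omega> (\<lambda>x. (case (t, x) of (t, x) \<Rightarrow> u' t x))"
      by (rule continuous_on_compose2[OF u']) (use t sub in \<open>auto intro!: continuous_intros\<close>)
    then have "u' t \<in> borel_measurable M"
      by (simp add: continuous_imp_measurable_on_sets_lebesgue open_domain)
    then show "dt T u t \<in> borel_measurable M"
      by (rule measurable_cong[THEN iffD1, rotated]) (use t dt in auto)
    fix x assume x: "x \<in> \<Omega>"
    show "norm (grad (u t) x) \<le> max K1 K2" "\<bar>dt T u t x\<bar> \<le> max K1 K2"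
      using K1[of "(t, x)"] K2[of "(t, x)"] t subsetD[OF sub x] grad[OF t x] dt[OF t x] by auto
  qed
qed

lemma Linf_Lq_space_2_bound:
  fixes f :: "real \<Rightarrow> real^'d \<Rightarrow> real"
  assumes "f \<in> Linf_Lq_space 2 T \<Omega>"
  obtains K where "AE t in L. f t \<in> Lp_space 2 M \<and> (\<integral>x. (f t x)\<^sup>2 \<partial>M) \<le> K"
proof -
  define g where "g t = Lp_norm 2 M (f t)" for t
  have g: "g \<in> borel_measurable L" and fin: "esssup L (\<lambda>t. ereal (norm (g t))) < \<infinity>"
    and f: "AE t in L. f t \<in> Lp_space 2 M"
    using assms by (auto simp: Linf_Lq_space_def Linf_space_def g_def[abs_def])
  obtain B where B: "esssup L (\<lambda>t. ereal (norm (g t))) \<le> ereal B"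
    using fin by (cases "esssup L (\<lambda>t. ereal (norm (g t)))") auto
  show thesis
  proof
    show "AE t in L. f t \<in> Lp_space 2 M \<and> (\<integral>x. (f t x)\<^sup>2 \<partial>M) \<le> B\<^sup>2"
      using f esssup_AE[of "\<lambda>t. ereal (norm (g t))" L]
    proof eventually_elim
      case (elim t)
      then have "ereal (norm (g t)) \<le> ereal B"
        using B by (meson order_trans)
      then have "sqrt (\<integral>x. (f t x)\<^sup>2 \<partial>M) \<le> B"
        by (simp add: g_def Lp_norm_2_eq)
      then have "(\<integral>x. (f t x)\<^sup>2 \<partial>M) \<le> B\<^sup>2"
        by (rule sqrt_le_D)
      then show ?case using elim by simp
    qed
  qed
qed

end

section \<open>Essential suprema: sign and measurability in a parameter\<close>

lemma Linf_norm_nonneg: "0 \<le> Linf_norm M u"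
proof (rule ccontr)
  let ?e = "esssup M (\<lambda>x. ereal (norm (u x)))"
  assume "\<not> 0 \<le> Linf_norm M u"
  then obtain r where r: "?e = ereal r" "r < 0"
    by (cases ?e) (auto simp: Linf_norm_def)
  then have meas: "(\<lambda>x. ereal (norm (u x))) \<in> borel_measurable M"
    by (auto simp: esssup_def top_ereal_def split: if_splits)
  \<comment> \<open>A finite negative value would make \<open>M\<close> null, but on a null measure
    the essential supremum is minus infinity.\<close>
  have "AE x in M. False"
    using esssup_AE[of "\<lambda>x. ereal (norm (u x))" M]
  proof eventually_elim
    case (elim x)
    then show False using r norm_ge_zero[of "u x"] by simp
  qed
  then have "AE x in M. ereal (norm (u x)) \<le> - \<infinity>"
    by eventually_elim simp
  then have "?e \<le> - \<infinity>"
    using meas by (rule esssup_I[rotated])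
  then show False using r by simp
qed

text \<open>The slice at \<open>t\<close> has essential supremum at most \<open>z\<close> exactly
  when the slice of the set where \<open>g > z\<close> is null, and the measure of slices is
  measurable in \<open>t\<close>. This gives the inner norm in \<open>coeff_dist\<close> the
  measurability that makes the outer essential supremum a genuine bound.\<close>

lemma (in sigma_finite_measure) measurable_esssup_slices:
  fixes g :: "'b \<Rightarrow> 'a \<Rightarrow> ereal"
  assumes g [measurable]: "(\<lambda>(t, x). g t x) \<in> borel_measurable (N \<Otimes>\<^sub>M M)"
  shows "(\<lambda>t. esssup M (g t)) \<in> borel_measurable N"
proof (rule borel_measurableI_le)
  fix z :: ereal
  have "{p \<in> space (N \<Otimes>\<^sub>M M). (case p of (t, x) \<Rightarrow> g t x) > z} \<in> sets (N \<Otimes>\<^sub>M M)"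
    by measurable
  note [measurable] = measurable_emeasure_Pair[OF this]
  have "esssup M (g t) \<le> z
      \<longleftrightarrow> emeasure M (Pair t -` {p \<in> space (N \<Otimes>\<^sub>M M). (case p of (t, x) \<Rightarrow> g t x) > z}) = 0"
    if t: "t \<in> space N" for t
  proof -
    have gt [measurable]: "g t \<in> borel_measurable M"
      using measurable_Pair2[OF g t] by simp
    have "emeasure M {x \<in> space M. g t x > z} = 0 \<longleftrightarrow> (AE x in M. g t x \<le> z)"
      by (subst AE_iff_measurable[OF _ refl]) (auto simp: not_le)
    also have "\<dots> \<longleftrightarrow> esssup M (g t) \<le> z"
      using esssup_AE[of "g t" M] by (auto intro!: esssup_I elim: eventually_mono)
    also have "{x \<in> space M. g t x > z} = Pair t -` {p \<in> space (N \<Otimes>\<^sub>M M). (case p of (t, x) \<Rightarrow> g t x) > z}"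
      using t by (auto simp: space_pair_measure)
    finally show ?thesis by simp
  qed
  then have "{t \<in> space N. esssup M (g t) \<le> z} = {t \<in> space N.
      emeasure M (Pair t -` {p \<in> space (N \<Otimes>\<^sub>M M). (case p of (t, x) \<Rightarrow> g t x) > z}) = 0}"
    by blast
  also have "\<dots> \<in> sets N"
    by measurable
  finally show "{t \<in> space N. esssup M (g t) \<le> z} \<in> sets N" .
qed

lemma Lp_space_diff:
  fixes v w :: "'a \<Rightarrow> 'b::{real_normed_vector, second_countable_topology}"
  assumes "v \<in> Lp_space p M" "w \<in> Lp_space p M" "0 < p"
  shows "(\<lambda>x. v x - w x) \<in> Lp_space p M"
    and "(\<integral>x. norm (v x - w x) powr p \<partial>M)
      \<le> 2 powr p * ((\<integral>x. norm (v x) powr p \<partial>M) + (\<integral>x. norm (w x) powr p \<partial>M))"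
proof -
  have [measurable]: "v \<in> borel_measurable M" "w \<in> borel_measurable M"
    and i: "integrable M (\<lambda>x. norm (v x) powr p)" "integrable M (\<lambda>x. norm (w x) powr p)"
    using assms by (auto simp: Lp_space_def)
  have j: "integrable M (\<lambda>x. 2 powr p * (norm (v x) powr p + norm (w x) powr p))"
    using i by simp
  have le: "norm (y - z) powr p \<le> 2 powr p * (norm y powr p + norm z powr p)" for y z :: 'b
  proof -
    have "norm (y - z) powr p \<le> (2 * max (norm y) (norm z)) powr p"
      using norm_triangle_ineq4[of y z] assms(3) by (intro powr_mono2) auto
    also have "\<dots> = 2 powr p * (max (norm y) (norm z)) powr p"
      by (simp add: powr_mult)
    also have "\<dots> \<le> 2 powr p * (norm y powr p + norm z powr p)"
      by (auto simp: max_def)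
    finally show ?thesis .
  qed
  have k: "integrable M (\<lambda>x. norm (v x - w x) powr p)"
    using le by (intro Bochner_Integration.integrable_bound[OF j]) auto
  then show "(\<lambda>x. v x - w x) \<in> Lp_space p M"
    by (simp add: Lp_space_def)
  show "(\<integral>x. norm (v x - w x) powr p \<partial>M)
      \<le> 2 powr p * ((\<integral>x. norm (v x) powr p \<partial>M) + (\<integral>x. norm (w x) powr p \<partial>M))"
    using integral_mono[OF k j le] i by simp
qed

section \<open>Solutions at a fixed time\<close>

locale weak_problem = space_time_domain \<Omega> T + generalized_polynomial N \<alpha> amin amax s
  for \<Omega> :: "(real^'d) set" and T :: real and N :: nat and \<alpha> :: "int \<Rightarrow> real" and amin amax s :: real +
  fixes D :: "(int \<Rightarrow> real) set" and b \<phi>_low \<phi>_up :: real and \<phi> \<rho>0 :: "real^'d \<Rightarrow> real"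
    and f \<Psi> :: "real \<Rightarrow> real^'d \<Rightarrow> real"
  assumes D_subset: "D \<subseteq> coeff_box N amin amax"
    and phi_meas [measurable]: "\<phi> \<in> borel_measurable M"
    and phi_low: "0 < \<phi>_low"
    and phi_bounds: "\<And>x. x \<in> \<Omega> \<Longrightarrow> \<phi>_low \<le> \<phi> x \<and> \<phi> x \<le> \<phi>_up"
    and f_space: "f \<in> Linf_Lq_space 2 T \<Omega>"
    and Psi_C12: "C12 \<Omega> T \<Psi>"
begin

definition good_coeff :: "(real^'d \<Rightarrow> int \<Rightarrow> real) \<Rightarrow> bool" where
  "good_coeff a \<longleftrightarrow> (\<forall>i\<in>{-1..int N}. (\<lambda>x. a x i) \<in> borel_measurable M) \<and>
     (AE x in M. a x \<in> coeff_box N amin amax)"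

definition flux :: "(real^'d \<Rightarrow> int \<Rightarrow> real) \<Rightarrow> (real^'d \<Rightarrow> real^'d) \<Rightarrow> real^'d \<Rightarrow> real^'d" where
  "flux a v x = F N \<alpha> (a x) (norm (v x)) *\<^sub>R v x"

text \<open>The problem frozen at one time: \<open>\<rho>'\<close> is merely some L2 function here,
  its relation to \<open>\<rho>\<close> being kept by \<open>has_time_derivative\<close>. The time
  \<open>t\<close> enters only through the data \<open>f\<close> and \<open>\<Psi>\<close>.\<close>

definition solves_at ::
  "real \<Rightarrow> (real^'d \<Rightarrow> int \<Rightarrow> real) \<Rightarrow> (real^'d \<Rightarrow> real^'d) \<Rightarrow> (real^'d \<Rightarrow> real) \<Rightarrow> (real^'d \<Rightarrow> real) \<Rightarrow>
   (real^'d \<Rightarrow> real) \<Rightarrow> bool" where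
  "solves_at t a m \<rho> \<rho>' divm \<longleftrightarrow>
     good_coeff a \<and> \<rho> \<in> Lp_space 2 M \<and> \<rho>' \<in> Lp_space 2 M \<and> V_with_div \<Omega> s m divm \<and>
     (\<forall>v w. V_with_div \<Omega> s v w \<longrightarrow>
        pairing \<Omega> (flux a m) v - pairing \<Omega> \<rho> w = - pairing \<Omega> (grad (\<Psi> t)) v) \<and>
     (\<forall>q \<in> Lp_space 2 M. pairing \<Omega> (\<lambda>x. \<phi> x * \<rho>' x) q + pairing \<Omega> divm q
        = pairing \<Omega> (f t) q - pairing \<Omega> (\<lambda>x. \<phi> x * dt T \<Psi> t x) q)"

lemma phi_nonneg: "\<forall>x\<in>\<Omega>. 0 \<le> \<phi> x \<and> \<phi> x \<le> \<phi>_up"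
  using phi_bounds phi_low by (meson less_imp_le order_trans)

lemma phi_abs: "x \<in> space M \<Longrightarrow> \<bar>\<phi> x\<bar> \<le> \<phi>_up"
  using phi_nonneg by auto

lemma admissible_coeff_measurable:
  assumes "admissible_coeff T \<Omega> N D b a" "i \<in> {-1..int N}"
  shows "(\<lambda>(t, x). a t x i) \<in> borel_measurable (L \<Otimes>\<^sub>M M)"
  using assms by (auto simp: admissible_coeff_def has_time_derivative_def space_time_def)

lemma admissible_coeff_good:
  assumes a: "admissible_coeff T \<Omega> N D b a"
  shows "AE t in L. good_coeff (a t)"
proof -
  have "AE z in L \<Otimes>\<^sub>M M. a (fst z) (snd z) \<in> D"
    using a unfolding admissible_coeff_def space_time_def case_prod_beta' by blast
  then have "AE t in L. AE x in M. a t x \<in> D"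
    using LM.AE_pair by fastforce
  then show ?thesis
  proof (rule AE_mp, intro AE_I2 impI)
    fix t assume t: "t \<in> space L" and D: "AE x in M. a t x \<in> D"
    have "(\<lambda>x. a t x i) \<in> borel_measurable M" if "i \<in> {-1..int N}" for i
      using measurable_Pair2[OF admissible_coeff_measurable[OF a that] t] by simp
    moreover have "AE x in M. a t x \<in> coeff_box N amin amax"
      using D D_subset by (auto elim: eventually_mono)
    ultimately show "good_coeff (a t)"
      by (simp add: good_coeff_def)
  qed
qed

lemma weak_solution_solves_at:
  assumes a: "admissible_coeff T \<Omega> N D b a"
    and sol: "weak_solution T \<Omega> N \<alpha> \<phi> f \<Psi> \<rho>0 a m \<rho>"
  obtains \<rho>' where "has_time_derivative T \<Omega> \<rho> \<rho>'" "\<rho>' \<in> Lp_Lq_space 1 2 T \<Omega>"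
    and "AE t in L. \<exists>divm. solves_at t (a t) (m t) (\<rho> t) (\<rho>' t) divm"
proof -
  obtain \<rho>' where 1: "has_time_derivative T \<Omega> \<rho> \<rho>'" "\<rho>' \<in> Lp_Lq_space 1 2 T \<Omega>"
    and 2: "AE t in L.
            (\<forall>v w. V_with_div \<Omega> s v w \<longrightarrow>
               pairing \<Omega> (\<lambda>x. F N \<alpha> (a t x) (norm (m t x)) *\<^sub>R m t x) v - pairing \<Omega> (\<rho> t) w
                 = - pairing \<Omega> (grad (\<Psi> t)) v) \<and>
            (\<exists>divm. V_with_div \<Omega> s (m t) divm \<and>
               (\<forall>q \<in> Lp_space 2 (lebesgue_on \<Omega>).
                  pairing \<Omega> (\<lambda>x. \<phi> x * \<rho>' t x) q + pairing \<Omega> divm q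
                    = pairing \<Omega> (f t) q - pairing \<Omega> (\<lambda>x. \<phi> x * dt T \<Psi> t x) q))"
    using sol unfolding weak_solution_def Let_def s_eq[symmetric] by blast
  have 3: "AE t in L. \<rho>' t \<in> Lp_space 2 M"
    using 1(2) by (simp add: Lp_Lq_space_def)
  have 4: "AE t in L. \<rho> t \<in> Lp_space 2 M"
    using sol by (intro AE_I2) (simp add: weak_solution_def Let_def)
  have "AE t in L. \<exists>divm. solves_at t (a t) (m t) (\<rho> t) (\<rho>' t) divm"
    using 2 3 4 admissible_coeff_good[OF a]
    by eventually_elim (simp add: solves_at_def flux_def[abs_def])
  with 1 that show thesis by blast
qed

text \<open>In place of Hoelder's inequality, both norms are replaced by their maximum
  \<open>z\<close>; the product is then at most a multiple of \<open>z + z powr s\<close>, hence of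
  1 plus the two s-th powers.\<close>

lemma flux_integrable:
  assumes a: "good_coeff a" and v: "v \<in> Lp_space s M" and w: "w \<in> Lp_space s M"
  shows "integrable M (\<lambda>x. flux a v x \<bullet> w x)"
proof -
  have [measurable]: "v \<in> borel_measurable M" "w \<in> borel_measurable M"
    and i: "integrable M (\<lambda>x. norm (v x) powr s)" "integrable M (\<lambda>x. norm (w x) powr s)"
    using v w by (auto simp: Lp_space_def)
  have [measurable]: "flux a v \<in> borel_measurable M"
    using a unfolding flux_def[abs_def] F_def good_coeff_def
    by (intro borel_measurable_scaleR borel_measurable_sum borel_measurable_times) auto
  have box: "AE x in M. a x \<in> coeff_box N amin amax"
    using a by (simp add: good_coeff_def)
  let ?K = "(real N + 2) * amax"
  let ?r = "\<lambda>x. ?K * (1 + 2 * (norm (v x) powr s + norm (w x) powr s))"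
  have "AE x in M. norm (flux a v x \<bullet> w x) \<le> norm (?r x)"
    using box
  proof eventually_elim
    case (elim x)
    define p q where "p = norm (v x)" and "q = norm (w x)"
    have pq: "0 \<le> p" "0 \<le> q" by (auto simp: p_def q_def)
    have K: "0 \<le> ?K"
      using coeff_box_bounds[OF elim, of 0] by simp
    define z where "z = max p q"
    have z: "0 \<le> z" "p \<le> z" "q \<le> z" "z powr s \<le> p powr s + q powr s"
      using pq by (auto simp: z_def max_def)
    have z1: "z \<le> 1 + z powr s"
    proof (cases "z \<le> 1")
      case False
      then show ?thesis using powr_mono[of 1 s z] s_gt_2 by simp
    qed (simp add: add_increasing2)
    have "\<bar>flux a v x \<bullet> w x\<bar> \<le> norm (flux a v x) * q"
      unfolding q_def by (rule Cauchy_Schwarz_ineq2)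
    also have "\<dots> = \<bar>F N \<alpha> (a x) p\<bar> * p * q"
      by (simp add: flux_def p_def)
    also have "\<dots> \<le> ?K * (1 + p powr (s - 1)) * q"
      using F_growth[OF elim pq(1)] pq by (intro mult_right_mono) auto
    also have "\<dots> \<le> ?K * (1 + z powr (s - 1)) * z"
    proof (rule mult_mono)
      have "p powr (s - 1) \<le> z powr (s - 1)"
        using pq z s_gt_2 by (intro powr_mono2) auto
      then show "?K * (1 + p powr (s - 1)) \<le> ?K * (1 + z powr (s - 1))"
        using K by (intro mult_left_mono) auto
    qed (use K z pq in auto)
    also have "\<dots> = ?K * (z + z * z powr (s - 1))"
      by (simp add: algebra_simps)
    also have "z * z powr (s - 1) = z powr s"
      using z by (simp add: powr_mult_base)
    also have "?K * (z + z powr s) \<le> ?K * (1 + 2 * (p powr s + q powr s))"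
      using K z z1 by (intro mult_left_mono) auto
    finally show ?case
      by (simp add: p_def q_def)
  qed
  moreover have "integrable M ?r"
    using i by simp
  ultimately show ?thesis
    by (intro Bochner_Integration.integrable_bound[where f = ?r and g = "\<lambda>x. flux a v x \<bullet> w x"]) measurable
qed

text \<open>The flux of any solution is an admissible test function and brings its own divergence
  \<open>d2\<close>; this allows testing across two solutions.\<close>

lemma solves_at_test:
  assumes "solves_at t a m \<rho> \<rho>' d" "solves_at t' a2 m2 \<rho>2 \<rho>2' d2"
  shows "(\<integral>x. \<rho> x * d2 x \<partial>M) = (\<integral>x. flux a m x \<bullet> m2 x \<partial>M) + (\<integral>x. grad (\<Psi> t) x \<bullet> m2 x \<partial>M)"
proof -
  have "V_with_div \<Omega> s m2 d2"
    using assms(2) by (simp add: solves_at_def)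
  then have "(\<integral>x. flux a m x \<bullet> m2 x \<partial>M) - (\<integral>x. \<rho> x * d2 x \<partial>M) = - (\<integral>x. grad (\<Psi> t) x \<bullet> m2 x \<partial>M)"
    using assms(1) unfolding solves_at_def pairing_def inner_real_def by blast
  then show ?thesis by linarith
qed

lemma solves_at_mass:
  assumes "solves_at t a m \<rho> \<rho>' d" "q \<in> Lp_space 2 M"
  shows "(\<integral>x. \<phi> x * \<rho>' x * q x \<partial>M) = (\<integral>x. f t x * q x \<partial>M) - (\<integral>x. \<phi> x * dt T \<Psi> t x * q x \<partial>M) - (\<integral>x. d x * q x \<partial>M)"
proof -
  have "(\<integral>x. \<phi> x * \<rho>' x * q x \<partial>M) + (\<integral>x. d x * q x \<partial>M)
      = (\<integral>x. f t x * q x \<partial>M) - (\<integral>x. \<phi> x * dt T \<Psi> t x * q x \<partial>M)"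
    using assms unfolding solves_at_def pairing_def inner_real_def by blast
  then show ?thesis by linarith
qed

lemma solves_at_spaces:
  assumes "solves_at t a m \<rho> \<rho>' d"
  shows "good_coeff a" "m \<in> Lp_space s M" "d \<in> Lp_space 2 M" "\<rho> \<in> Lp_space 2 M" "\<rho>' \<in> Lp_space 2 M"
  using assms by (auto simp: solves_at_def V_with_div_def)

text \<open>Both momentum equations are tested with \<open>m1\<close> and with \<open>m2\<close> separately: this way the divergence
  of \<open>m1 - m2\<close> never has to be considered.\<close>

lemma solves_at_difference:
  assumes 1: "solves_at t a1 m1 \<rho>1 \<rho>1' d1" and 2: "solves_at t a2 m2 \<rho>2 \<rho>2' d2"
  shows "(\<integral>x. \<phi> x * (\<rho>1' x - \<rho>2' x) * (\<rho>1 x - \<rho>2 x) \<partial>M)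
    = - (\<integral>x. (flux a1 m1 x - flux a2 m2 x) \<bullet> (m1 x - m2 x) \<partial>M)"
proof -
  note s1 = solves_at_spaces[OF 1] and s2 = solves_at_spaces[OF 2]
  let ?q = "\<lambda>x. \<rho>1 x - \<rho>2 x"
  have q: "?q \<in> Lp_space 2 M"
    by (rule Lp_space_diff_2[OF s1(4) s2(4)])
  note int_phi = integrable_mult_Lp_2[OF mult_bounded_Lp_2[OF _ phi_meas phi_abs] q]
  note int_d = integrable_mult_Lp_2[OF s1(4) s1(3)] integrable_mult_Lp_2[OF s1(4) s2(3)]
    integrable_mult_Lp_2[OF s2(4) s1(3)] integrable_mult_Lp_2[OF s2(4) s2(3)]
  note int_F = flux_integrable[OF s1(1,2) s1(2)] flux_integrable[OF s1(1,2) s2(2)]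
    flux_integrable[OF s2(1,2) s1(2)] flux_integrable[OF s2(1,2) s2(2)]
  have "(\<integral>x. \<phi> x * (\<rho>1' x - \<rho>2' x) * ?q x \<partial>M)
      = (\<integral>x. \<phi> x * \<rho>1' x * ?q x - \<phi> x * \<rho>2' x * ?q x \<partial>M)"
    by (simp add: algebra_simps)
  also have "\<dots> = (\<integral>x. \<phi> x * \<rho>1' x * ?q x \<partial>M) - (\<integral>x. \<phi> x * \<rho>2' x * ?q x \<partial>M)"
    using int_phi[OF s1(5)] int_phi[OF s2(5)] by (rule Bochner_Integration.integral_diff)
  also have "\<dots> = (\<integral>x. d2 x * ?q x \<partial>M) - (\<integral>x. d1 x * ?q x \<partial>M)"
    using solves_at_mass[OF 1 q] solves_at_mass[OF 2 q] by simp
  also have "(\<integral>x. d2 x * ?q x \<partial>M) = (\<integral>x. \<rho>1 x * d2 x \<partial>M) - (\<integral>x. \<rho>2 x * d2 x \<partial>M)"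
    using int_d by (simp add: right_diff_distrib mult.commute)
  also have "(\<integral>x. d1 x * ?q x \<partial>M) = (\<integral>x. \<rho>1 x * d1 x \<partial>M) - (\<integral>x. \<rho>2 x * d1 x \<partial>M)"
    using int_d by (simp add: right_diff_distrib mult.commute)
  \<comment> \<open>Both pairings with \<open>d2\<close> carry the same integral of
    \<open>grad (\<Psi> t) x \<bullet> m2 x\<close>, and both with \<open>d1\<close> that of
    \<open>grad (\<Psi> t) x \<bullet> m1 x\<close>, so the boundary data cancel.\<close>
  finally have "(\<integral>x. \<phi> x * (\<rho>1' x - \<rho>2' x) * ?q x \<partial>M)
      = (\<integral>x. flux a1 m1 x \<bullet> m2 x \<partial>M) - (\<integral>x. flux a2 m2 x \<bullet> m2 x \<partial>M)
        - ((\<integral>x. flux a1 m1 x \<bullet> m1 x \<partial>M) - (\<integral>x. flux a2 m2 x \<bullet> m1 x \<partial>M))"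
    using solves_at_test[OF 1 1] solves_at_test[OF 1 2] solves_at_test[OF 2 1] solves_at_test[OF 2 2]
    by simp
  also have "\<dots> = - (\<integral>x. (flux a1 m1 x - flux a2 m2 x) \<bullet> (m1 x - m2 x) \<partial>M)"
    using int_F by (simp add: inner_diff_left inner_diff_right)
  finally show ?thesis .
qed

text \<open>Integrating \<open>F_difference_estimate\<close> over \<open>\<Omega>\<close> produces
  twice the flux pairing, which by \<open>solves_at_difference\<close> is minus the rate of change
  of the weighted energy.\<close>

lemma difference_rate:
  assumes 1: "solves_at t a1 m1 \<rho>1 \<rho>1' d1" and 2: "solves_at t a2 m2 \<rho>2 \<rho>2' d2"
    and d: "AE x in M. \<forall>i\<in>{-1..int N}. \<bar>a1 x i - a2 x i\<bar> \<le> d"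
  shows "amin * 2 powr (1 - s) * (\<integral>x. norm (m1 x - m2 x) powr s \<partial>M)
      + 2 * (\<integral>x. \<phi> x * (\<rho>1' x - \<rho>2' x) * (\<rho>1 x - \<rho>2 x) \<partial>M)
    \<le> diff_const * d powr (s / (s - 1)) * (measure M \<Omega> + (\<integral>x. norm (m2 x) powr s \<partial>M))"
proof -
  note s1 = solves_at_spaces[OF 1] and s2 = solves_at_spaces[OF 2]
  have im: "integrable M (\<lambda>x. norm (m1 x - m2 x) powr s)" "integrable M (\<lambda>x. norm (m2 x) powr s)"
  proof -
    show "integrable M (\<lambda>x. norm (m1 x - m2 x) powr s)"
      using Lp_space_diff(1)[OF s1(2) s2(2)] s_gt_2 by (simp add: Lp_space_def)
    show "integrable M (\<lambda>x. norm (m2 x) powr s)"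
      using s2(2) by (simp add: Lp_space_def)
  qed
  have iF: "integrable M (\<lambda>x. (flux a1 m1 x - flux a2 m2 x) \<bullet> (m1 x - m2 x))"
    using flux_integrable[OF s1(1,2) s1(2)] flux_integrable[OF s1(1,2) s2(2)]
    flux_integrable[OF s2(1,2) s1(2)] flux_integrable[OF s2(1,2) s2(2)]
    by (simp add: inner_diff_left inner_diff_right)
  have box: "AE x in M. a1 x \<in> coeff_box N amin amax"
    using s1(1) by (simp add: good_coeff_def)
  have "(\<integral>x. amin * 2 powr (1 - s) * norm (m1 x - m2 x) powr s \<partial>M)
      \<le> (\<integral>x. 2 * ((flux a1 m1 x - flux a2 m2 x) \<bullet> (m1 x - m2 x))
          + diff_const * d powr (s / (s - 1)) * (1 + norm (m2 x) powr s) \<partial>M)"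
  proof (rule integral_mono_AE)
    show "AE x in M. amin * 2 powr (1 - s) * norm (m1 x - m2 x) powr s
      \<le> 2 * ((flux a1 m1 x - flux a2 m2 x) \<bullet> (m1 x - m2 x))
          + diff_const * d powr (s / (s - 1)) * (1 + norm (m2 x) powr s)"
      using box d
    proof eventually_elim
      case (elim x)
      show ?case
        using F_difference_estimate[OF elim(1), of "a2 x" d "m1 x" "m2 x"] elim(2)
        by (simp add: flux_def)
    qed
  qed (use im iF in simp_all)
  also have "\<dots> = 2 * (\<integral>x. (flux a1 m1 x - flux a2 m2 x) \<bullet> (m1 x - m2 x) \<partial>M)
      + diff_const * d powr (s / (s - 1)) * (measure M \<Omega> + (\<integral>x. norm (m2 x) powr s \<partial>M))"
    using im iF by simp
  finally show ?thesis
    using im unfolding solves_at_difference[OF 1 2] by simp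
qed

text \<open>The exceptional times come from the bound on \<open>f\<close> alone, so the quantifier
  over solutions can stand inside the AE and \<open>K\<close> depends on the data only. The weight
  \<open>e\<close> stays free, to be tuned to \<open>T\<close> and \<open>\<phi>_low\<close>
  later.\<close>

lemma apriori_rate:
  obtains K where "0 \<le> K"
    and "AE t in L. \<forall>a m \<rho> \<rho>' d e. solves_at t a m \<rho> \<rho>' d \<longrightarrow> 0 < e \<longrightarrow>
      amin * 2 powr (1 - s) * (\<integral>x. norm (m x) powr s \<partial>M) + 2 * (\<integral>x. \<phi> x * \<rho>' x * \<rho> x \<partial>M)
      \<le> K / e + K + e * (\<integral>x. (\<rho> x)\<^sup>2 \<partial>M)"
proof -
  define c where "c = amin * 2 powr (1 - s)"
  have c: "0 < c" using amin_pos by (simp add: c_def)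
  obtain K1' where grad_meas: "\<And>t. t \<in> {0..T} \<Longrightarrow> grad (\<Psi> t) \<in> borel_measurable M"
    and dt_meas: "\<And>t. t \<in> {0..T} \<Longrightarrow> dt T \<Psi> t \<in> borel_measurable M"
    and grad_le': "\<And>t x. t \<in> {0..T} \<Longrightarrow> x \<in> \<Omega> \<Longrightarrow> norm (grad (\<Psi> t) x) \<le> K1'"
    and dt_le': "\<And>t x. t \<in> {0..T} \<Longrightarrow> x \<in> \<Omega> \<Longrightarrow> \<bar>dt T \<Psi> t x\<bar> \<le> K1'"
    using C12_derivatives[OF Psi_C12] by blast
  \<comment> \<open>For empty \<open>\<Omega>\<close> the bound \<open>K1'\<close> may be negative,
    whereas Young's inequality wants a nonnegative factor.\<close>
  define K1 where "K1 = max 0 K1'"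
  have K1: "0 \<le> K1" by (simp add: K1_def)
  have grad_le: "norm (grad (\<Psi> t) x) \<le> K1" and dt_le: "\<bar>dt T \<Psi> t x\<bar> \<le> K1" if "t \<in> {0..T}" "x \<in> \<Omega>" for t x
    using grad_le'[OF that] dt_le'[OF that] by (auto simp: K1_def)
  obtain K2 where K2: "AE t in L. f t \<in> Lp_space 2 M \<and> (\<integral>x. (f t x)\<^sup>2 \<partial>M) \<le> K2"
    using Linf_Lq_space_2_bound[OF f_space] .
  \<comment> \<open>\<open>J\<close> bounds the squared L2 norm of the source
    \<open>f - \<phi> * dt T \<Psi>\<close>. \<open>B\<close> is the pointwise Young remainder left
    after half of the coercivity has absorbed the term with \<open>grad (\<Psi> t)\<close>.\<close>
  define J where "J = 2 * \<bar>K2\<bar> + 2 * ((\<phi>_up * K1)\<^sup>2 * measure M \<Omega>)"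
  define B where "B = (2 / c) powr (1 / (s - 1)) * K1 powr (s / (s - 1))"
  define K where "K = J + 2 * B * measure M \<Omega>"
  have J0: "0 \<le> J" and B0: "0 \<le> B"
    by (auto simp: J_def B_def)
  have "AE t in L. \<forall>a m \<rho> \<rho>' d e. solves_at t a m \<rho> \<rho>' d \<longrightarrow> 0 < e \<longrightarrow>
      c * (\<integral>x. norm (m x) powr s \<partial>M) + 2 * (\<integral>x. \<phi> x * \<rho>' x * \<rho> x \<partial>M)
      \<le> K / e + K + e * (\<integral>x. (\<rho> x)\<^sup>2 \<partial>M)"
    using K2
  proof (rule AE_mp, intro AE_I2 impI allI)
    fix t a m \<rho> \<rho>' d and e :: real
    assume "t \<in> space L" and ft: "f t \<in> Lp_space 2 M \<and> (\<integral>x. (f t x)\<^sup>2 \<partial>M) \<le> K2"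
      and sol: "solves_at t a m \<rho> \<rho>' d" and e: "0 < e"
    then have t: "t \<in> {0..T}" by simp
    note sp = solves_at_spaces[OF sol]
    have [measurable]: "grad (\<Psi> t) \<in> borel_measurable M" "dt T \<Psi> t \<in> borel_measurable M"
      using grad_meas dt_meas t by auto
    have [measurable]: "m \<in> borel_measurable M" and im: "integrable M (\<lambda>x. norm (m x) powr s)"
      using sp(2) by (auto simp: Lp_space_def)
    let ?S = "\<integral>x. norm (m x) powr s \<partial>M" and ?p = "\<lambda>x. \<phi> x * dt T \<Psi> t x"

    have iF: "integrable M (\<lambda>x. flux a m x \<bullet> m x)"
      by (rule flux_integrable[OF sp(1,2,2)])
    have "(\<integral>x. c * norm (m x) powr s \<partial>M) \<le> (\<integral>x. flux a m x \<bullet> m x \<partial>M)"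
    proof (rule integral_mono_AE)
      have "AE x in M. a x \<in> coeff_box N amin amax"
        using sp(1) by (simp add: good_coeff_def)
      then show "AE x in M. c * norm (m x) powr s \<le> flux a m x \<bullet> m x"
        unfolding c_def flux_def by eventually_elim (rule F_coercive)
    qed (use im iF in simp_all)
    then have F: "c * ?S \<le> (\<integral>x. flux a m x \<bullet> m x \<partial>M)"
      by simp

    have G_pt: "\<bar>grad (\<Psi> t) x \<bullet> m x\<bar> \<le> c / 2 * norm (m x) powr s + B" if "x \<in> space M" for x
    proof -
      have "\<bar>grad (\<Psi> t) x \<bullet> m x\<bar> \<le> norm (grad (\<Psi> t) x) * norm (m x)"
        by (rule Cauchy_Schwarz_ineq2)
      also have "\<dots> \<le> norm (m x) * K1"
        using mult_right_mono[OF grad_le[OF t, of x] norm_ge_zero[of "m x"]] that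
        by (simp add: mult.commute)
      also have "\<dots> \<le> c / 2 * norm (m x) powr s + B"
        using mult_le_absorb_powr[of "c / 2" s "norm (m x)" K1] c s_gt_2 K1 by (simp add: B_def)
      finally show ?thesis .
    qed
    have iB: "integrable M (\<lambda>x. c / 2 * norm (m x) powr s + B)"
      using im by simp
    have iG: "integrable M (\<lambda>x. grad (\<Psi> t) x \<bullet> m x)"
    proof (rule Bochner_Integration.integrable_bound[OF iB])
      show "AE x in M. norm (grad (\<Psi> t) x \<bullet> m x) \<le> norm (c / 2 * norm (m x) powr s + B)"
        using G_pt by (intro AE_I2) (metis abs_ge_self order_trans real_norm_def)
    qed measurable
    have "(\<integral>x. - (grad (\<Psi> t) x \<bullet> m x) \<partial>M) \<le> (\<integral>x. c / 2 * norm (m x) powr s + B \<partial>M)"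
    proof (rule integral_mono[OF _ iB])
      show "integrable M (\<lambda>x. - (grad (\<Psi> t) x \<bullet> m x))" using iG by simp
      show "- (grad (\<Psi> t) x \<bullet> m x) \<le> c / 2 * norm (m x) powr s + B" if "x \<in> space M" for x
        using G_pt[OF that] by linarith
    qed
    then have G: "- (\<integral>x. grad (\<Psi> t) x \<bullet> m x \<partial>M) \<le> c * ?S / 2 + B * measure M \<Omega>"
      using im by (simp add: mult.commute)

    have p_le: "\<bar>?p x\<bar> \<le> \<phi>_up * K1" if "x \<in> space M" for x
      using phi_abs[OF that] dt_le[OF t, of x] that
      by (auto simp: abs_mult intro!: mult_mono order_trans[OF abs_ge_zero])
    have p_sq: "(?p x)\<^sup>2 \<le> (\<phi>_up * K1)\<^sup>2" if "x \<in> space M" for x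
      using power_mono[OF p_le[OF that], of 2] by simp
    have ip: "integrable M (\<lambda>x. (?p x)\<^sup>2)"
      by (rule Bochner_Integration.integrable_bound[of M "\<lambda>_. (\<phi>_up * K1)\<^sup>2"])
         (use p_sq in \<open>auto intro!: AE_I2\<close>)
    then have p: "?p \<in> Lp_space 2 M"
      by (simp add: mem_Lp_space_2_iff)
    have "(\<integral>x. (?p x)\<^sup>2 \<partial>M) \<le> (\<integral>x. (\<phi>_up * K1)\<^sup>2 \<partial>M)"
      by (rule integral_mono[OF ip]) (use p_sq in auto)
    then have p2: "(\<integral>x. (?p x)\<^sup>2 \<partial>M) \<le> (\<phi>_up * K1)\<^sup>2 * measure M \<Omega>"
      by (simp add: mult.commute)
    let ?h = "\<lambda>x. f t x - ?p x"
    have h: "?h \<in> Lp_space 2 M" and h2: "(\<integral>x. (?h x)\<^sup>2 \<partial>M) \<le> J"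
      using Lp_space_diff_2[OF _ p, of "f t"] ft p2 by (auto simp: J_def)
    have "2 * (\<integral>x. ?h x * \<rho> x \<partial>M) = (\<integral>x. 2 * (?h x * \<rho> x) \<partial>M)"
      by simp
    also have "\<dots> \<le> (\<integral>x. (?h x)\<^sup>2 / e + e * (\<rho> x)\<^sup>2 \<partial>M)"
    proof (rule integral_mono)
      show "integrable M (\<lambda>x. 2 * (?h x * \<rho> x))"
        using integrable_mult_Lp_2[OF h sp(4)] by simp
      show "integrable M (\<lambda>x. (?h x)\<^sup>2 / e + e * (\<rho> x)\<^sup>2)"
        using h sp(4) by (simp add: mem_Lp_space_2_iff)
      fix x
      have "0 \<le> (?h x - e * \<rho> x)\<^sup>2 / e"
        using e by simp
      also have "\<dots> = (?h x)\<^sup>2 / e + e * (\<rho> x)\<^sup>2 - 2 * (?h x * \<rho> x)"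
        using e by (simp add: power2_eq_square field_simps)
      finally show "2 * (?h x * \<rho> x) \<le> (?h x)\<^sup>2 / e + e * (\<rho> x)\<^sup>2"
        by simp
    qed
    also have "\<dots> = (\<integral>x. (?h x)\<^sup>2 \<partial>M) / e + e * (\<integral>x. (\<rho> x)\<^sup>2 \<partial>M)"
      using h sp(4) by (simp add: mem_Lp_space_2_iff)
    also have "\<dots> \<le> J / e + e * (\<integral>x. (\<rho> x)\<^sup>2 \<partial>M)"
      using h2 e by (simp add: divide_right_mono)
    finally have H: "2 * (\<integral>x. ?h x * \<rho> x \<partial>M) \<le> J / e + e * (\<integral>x. (\<rho> x)\<^sup>2 \<partial>M)" .

    have "(\<integral>x. ?h x * \<rho> x \<partial>M) = (\<integral>x. f t x * \<rho> x \<partial>M) - (\<integral>x. ?p x * \<rho> x \<partial>M)"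
      unfolding left_diff_distrib
      using ft by (intro Bochner_Integration.integral_diff integrable_mult_Lp_2 p sp) auto
    moreover have "(\<integral>x. d x * \<rho> x \<partial>M) = (\<integral>x. \<rho> x * d x \<partial>M)"
      by (simp add: mult.commute)
    ultimately have X: "(\<integral>x. \<phi> x * \<rho>' x * \<rho> x \<partial>M) = (\<integral>x. ?h x * \<rho> x \<partial>M)
        - (\<integral>x. flux a m x \<bullet> m x \<partial>M) - (\<integral>x. grad (\<Psi> t) x \<bullet> m x \<partial>M)"
      using solves_at_mass[OF sol sp(4)] solves_at_test[OF sol sol] by linarith
    \<comment> \<open>In twice the identity \<open>X\<close>, coercivity gives
      \<open>2 * c * ?S\<close> and the gradient term costs \<open>c * ?S\<close>; what remains is
      exactly the \<open>c * ?S\<close> of the claim.\<close>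
    have "J / e + 2 * (B * measure M \<Omega>) \<le> K / e + K"
      using J0 B0 e by (simp add: K_def add_divide_distrib)
    then show "c * ?S + 2 * (\<integral>x. \<phi> x * \<rho>' x * \<rho> x \<partial>M) \<le> K / e + K + e * (\<integral>x. (\<rho> x)\<^sup>2 \<partial>M)"
      using X F G H by argo
  qed
  moreover have "0 \<le> K"
    using J0 B0 by (simp add: K_def)
  ultimately show thesis
    using that by (simp add: c_def)
qed

section \<open>Estimates over the time interval\<close>

text \<open>Integrating the rate up to \<open>t\<close> bounds the sum of energy and dissipation.
  Both are nonnegative, so either may be dropped, the energy at \<open>t = T\<close>.\<close>

lemma energy_estimate:
  assumes u: "has_time_derivative T \<Omega> u u'" "u' \<in> Lp_Lq_space 1 2 T \<Omega>" "u 0 \<in> Lp_space 2 M"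
    and S: "integrable L S" "\<And>t. 0 \<le> S t" and Y: "integrable L Y" "\<And>t. 0 \<le> Y t" and c: "0 \<le> c"
    and rate: "AE t in L. c * S t + 2 * (\<integral>x. \<phi> x * u' t x * u t x \<partial>M) \<le> Y t"
  shows "\<And>t. t \<in> {0..T} \<Longrightarrow>
      (\<integral>x. \<phi> x * (u t x)\<^sup>2 \<partial>M) \<le> (\<integral>x. \<phi> x * (u 0 x)\<^sup>2 \<partial>M) + (\<integral>t. Y t \<partial>L)"
    and "c * (\<integral>t. S t \<partial>L) \<le> (\<integral>x. \<phi> x * (u 0 x)\<^sup>2 \<partial>M) + (\<integral>t. Y t \<partial>L)"
proof -
  note energy = energy_identity[OF u phi_meas phi_nonneg]
  let ?X = "\<lambda>r. \<integral>x. \<phi> x * u' r x * u r x \<partial>M"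
  have ind: "integrable L (\<lambda>r. indicator {..t} r * h r)" if "integrable L h" for t and h :: "real \<Rightarrow> real"
  proof (rule Bochner_Integration.integrable_bound[OF that])
    have [measurable]: "{..t} \<inter> {0..T} \<in> sets L"
      by (auto simp: sets_restrict_space)
    have "(\<lambda>r. indicator ({..t} \<inter> {0..T}) r * h r) \<in> borel_measurable L"
      using that by measurable
    then show "(\<lambda>r. indicator {..t} r * h r) \<in> borel_measurable L"
      by (rule measurable_cong[THEN iffD1, rotated]) (simp add: indicator_def)
  qed (auto simp: indicator_def)
  have main: "(\<integral>x. \<phi> x * (u t x)\<^sup>2 \<partial>M) + c * (\<integral>r. indicator {..t} r * S r \<partial>L)
      \<le> (\<integral>x. \<phi> x * (u 0 x)\<^sup>2 \<partial>M) + (\<integral>r. Y r \<partial>L)" if t: "t \<in> {0..T}" for t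
  proof -
    have "(\<integral>r. c * (indicator {..t} r * S r) + 2 * (indicator {..t} r * ?X r) \<partial>L) \<le> (\<integral>r. Y r \<partial>L)"
    proof (rule integral_mono_AE)
      \<comment> \<open>After time \<open>t\<close> the left side is 0, and \<open>Y\<close> is
        nonnegative; this allows the full integral of \<open>Y\<close> on the right.\<close>
      show "AE r in L. c * (indicator {..t} r * S r) + 2 * (indicator {..t} r * ?X r) \<le> Y r"
        using rate Y(2) by (auto elim!: eventually_mono simp: indicator_def)
    qed (use Y ind[OF S(1)] energy(1) in simp_all)
    then show ?thesis
      using energy(2)[OF t] ind[OF S(1), of t] energy(1)[of t] by simp
  qed
  show "(\<integral>x. \<phi> x * (u t x)\<^sup>2 \<partial>M) \<le> (\<integral>x. \<phi> x * (u 0 x)\<^sup>2 \<partial>M) + (\<integral>t. Y t \<partial>L)"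
    if "t \<in> {0..T}" for t
  proof -
    have "0 \<le> c * (\<integral>r. indicator {..t} r * S r \<partial>L)"
      using c S(2) by (intro mult_nonneg_nonneg Bochner_Integration.integral_nonneg) auto
    then show ?thesis using main[OF that] by linarith
  qed
  have "0 \<le> (\<integral>x. \<phi> x * (u T x)\<^sup>2 \<partial>M)"
    using phi_nonneg by (intro Bochner_Integration.integral_nonneg_AE AE_I2) auto
  moreover have "(\<integral>r. indicator {..T} r * S r \<partial>L) = (\<integral>r. S r \<partial>L)"
    by (intro Bochner_Integration.integral_cong) (auto simp: indicator_def)
  ultimately show "c * (\<integral>t. S t \<partial>L) \<le> (\<integral>x. \<phi> x * (u 0 x)\<^sup>2 \<partial>M) + (\<integral>t. Y t \<partial>L)"
    using main[of T] T_pos by simp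
qed

lemma Lp_2_le_weighted:
  assumes u: "u \<in> Lp_space 2 M"
  shows "(\<integral>x. (u x)\<^sup>2 \<partial>M) \<le> (\<integral>x. \<phi> x * (u x)\<^sup>2 \<partial>M) / \<phi>_low"
proof -
  have "(\<integral>x. \<phi>_low * (u x)\<^sup>2 \<partial>M) \<le> (\<integral>x. \<phi> x * (u x)\<^sup>2 \<partial>M)"
  proof (rule integral_mono)
    show "integrable M (\<lambda>x. \<phi> x * (u x)\<^sup>2)"
      using integrable_mult_Lp_2[OF mult_bounded_Lp_2[OF u phi_meas phi_abs] u]
      by (simp add: power2_eq_square mult.assoc)
  qed (use u phi_bounds in \<open>auto simp: mem_Lp_space_2_iff intro: mult_right_mono\<close>)
  then show ?thesis
    using phi_low by (simp add: field_simps)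
qed

lemma weak_solution_flux_power:
  assumes "weak_solution T \<Omega> N \<alpha> \<phi> f \<Psi> \<rho>0 a m \<rho>"
  shows "m \<in> Lp_Lq_space s s T \<Omega>" "integrable L (\<lambda>t. \<integral>x. norm (m t x) powr s \<partial>M)"
proof -
  show m: "m \<in> Lp_Lq_space s s T \<Omega>"
    using assms by (simp add: weak_solution_def Let_def s_eq)
  then show "integrable L (\<lambda>t. \<integral>x. norm (m t x) powr s \<partial>M)"
    using s_gt_2 by (simp add: Lp_Lq_space_def Lp_space_def Lp_norm_nonneg Lp_norm_powr)
qed

lemma weak_solution_initial:
  assumes "weak_solution T \<Omega> N \<alpha> \<phi> f \<Psi> \<rho>0 a m \<rho>"
  shows "\<And>t. t \<in> {0..T} \<Longrightarrow> \<rho> t \<in> Lp_space 2 M" "\<rho> 0 \<in> Lp_space 2 M"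
    and "AE x in M. \<rho> 0 x = \<rho>0 x - \<Psi> 0 x"
  using assms T_pos by (auto simp: weak_solution_def Let_def)

text \<open>To serve all solutions at once, the initial energy is expressed through
  \<open>\<rho>0\<close> and \<open>\<Psi>\<close>, and the weight \<open>e\<close> through
  \<open>T\<close> and \<open>\<phi>_low\<close>.\<close>

lemma apriori_bound:
  obtains K where "0 \<le> K"
    and "\<And>a m \<rho>. admissible_coeff T \<Omega> N D b a \<Longrightarrow> weak_solution T \<Omega> N \<alpha> \<phi> f \<Psi> \<rho>0 a m \<rho> \<Longrightarrow>
      (\<integral>t. \<integral>x. norm (m t x) powr s \<partial>M \<partial>L) \<le> K"
proof -
  define c where "c = amin * 2 powr (1 - s)"
  have c: "0 < c" using amin_pos by (simp add: c_def)
  obtain K where K: "0 \<le> K"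
    and rate: "AE t in L. \<forall>a m \<rho> \<rho>' d e. solves_at t a m \<rho> \<rho>' d \<longrightarrow> 0 < e \<longrightarrow>
      c * (\<integral>x. norm (m x) powr s \<partial>M) + 2 * (\<integral>x. \<phi> x * \<rho>' x * \<rho> x \<partial>M)
      \<le> K / e + K + e * (\<integral>x. (\<rho> x)\<^sup>2 \<partial>M)"
    unfolding c_def using apriori_rate by blast
  \<comment> \<open>\<open>\<rho>0\<close> is not assumed measurable, so changing it on a null set is only safe inside \<open>\<integral>\<^sup>+\<close>.\<close>
  define E0 where "E0 = enn2real (\<integral>\<^sup>+x. ennreal (\<phi> x * (\<rho>0 x - \<Psi> 0 x)\<^sup>2) \<partial>M)"
  \<comment> \<open>An L2 norm squared is at most its weighted version divided by
    \<open>\<phi>_low\<close>, and the interval has length \<open>T\<close>; hence the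
    \<open>e\<close>-term integrates to at most half the supremum of the energy.\<close>
  define e where "e = \<phi>_low / (2 * T)"
  have e: "0 < e" using phi_low T_pos by (simp add: e_def)
  define A where "A = E0 + T * (K / e + K)"
  have "0 \<le> A"
    using K e T_pos by (auto simp: A_def E0_def)
  moreover have "(\<integral>t. \<integral>x. norm (m t x) powr s \<partial>M \<partial>L) \<le> 2 * A / c"
    if a: "admissible_coeff T \<Omega> N D b a" and sol: "weak_solution T \<Omega> N \<alpha> \<phi> f \<Psi> \<rho>0 a m \<rho>" for a m \<rho>
  proof -
    obtain \<rho>' where \<rho>': "has_time_derivative T \<Omega> \<rho> \<rho>'" "\<rho>' \<in> Lp_Lq_space 1 2 T \<Omega>"
      and at: "AE t in L. \<exists>divm. solves_at t (a t) (m t) (\<rho> t) (\<rho>' t) divm"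
      using weak_solution_solves_at[OF a sol] .
    note init = weak_solution_initial[OF sol]
    have [measurable]: "\<rho> 0 \<in> borel_measurable M"
      using init(2) by (simp add: mem_Lp_space_2_iff)
    define E where "E t = (\<integral>x. \<phi> x * (\<rho> t x)\<^sup>2 \<partial>M)" for t
    have "E 0 = enn2real (\<integral>\<^sup>+x. ennreal (\<phi> x * (\<rho> 0 x)\<^sup>2) \<partial>M)"
      unfolding E_def using phi_nonneg by (intro integral_eq_nn_integral AE_I2) auto
    also have "(\<integral>\<^sup>+x. ennreal (\<phi> x * (\<rho> 0 x)\<^sup>2) \<partial>M) = (\<integral>\<^sup>+x. ennreal (\<phi> x * (\<rho>0 x - \<Psi> 0 x)\<^sup>2) \<partial>M)"
      using init(3) by (intro nn_integral_cong_AE) (auto elim!: eventually_mono)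
    finally have E0: "E 0 = E0"
      by (simp add: E0_def)
    have E_nonneg: "0 \<le> E t" for t
      unfolding E_def using phi_nonneg by (intro Bochner_Integration.integral_nonneg_AE AE_I2) auto
    \<comment> \<open>Finiteness of the supremum is what allows \<open>S \<le> A + S / 2\<close> to
      be solved for \<open>S\<close>. \<open>B\<close> depends on the solution but leaves no trace
      in the final constant.\<close>
    obtain B where B: "\<And>t. t \<in> {0..T} \<Longrightarrow> E t \<le> B"
      using energy_identity(3)[OF \<rho>' init(2) phi_meas phi_nonneg] unfolding E_def by blast
    \<comment> \<open>The choice of \<open>e\<close> turns the energy balance into \<open>E t \<le> A + S / 2\<close>, so no Gronwall argument is needed.\<close>
    define S where "S = (SUP t\<in>{0..T}. E t)"
    have E_le: "E t \<le> S" if "t \<in> {0..T}" for t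
      unfolding S_def using that B by (intro cSUP_upper bdd_aboveI[of _ B]) auto
    have S0: "0 \<le> S"
      using E_le[of 0] E_nonneg[of 0] T_pos by simp
    define Y where "Y = K / e + K + S / (2 * T)"
    have Y0: "0 \<le> Y"
      using K e S0 T_pos by (simp add: Y_def)
    have Y_int: "(\<integral>t. Y \<partial>L) = T * (K / e + K) + S / 2"
      using T_pos by (simp add: Y_def measure_restrict_space field_simps)
    have rate': "AE t in L. c * (\<integral>x. norm (m t x) powr s \<partial>M) + 2 * (\<integral>x. \<phi> x * \<rho>' t x * \<rho> t x \<partial>M) \<le> Y"
    proof (rule AE_mp[OF AE_conjI[OF rate at]], intro AE_I2 impI)
      fix t assume t: "t \<in> space L" and *: "(\<forall>a m \<rho> \<rho>' d e. solves_at t a m \<rho> \<rho>' d \<longrightarrow> 0 < e \<longrightarrow>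
          c * (\<integral>x. norm (m x) powr s \<partial>M) + 2 * (\<integral>x. \<phi> x * \<rho>' x * \<rho> x \<partial>M)
          \<le> K / e + K + e * (\<integral>x. (\<rho> x)\<^sup>2 \<partial>M)) \<and> (\<exists>divm. solves_at t (a t) (m t) (\<rho> t) (\<rho>' t) divm)"
      have "(\<integral>x. (\<rho> t x)\<^sup>2 \<partial>M) \<le> S / \<phi>_low"
        using Lp_2_le_weighted[OF init(1)[of t]] E_le[of t] t phi_low
        by (simp add: E_def field_simps)
      then have "e * (\<integral>x. (\<rho> t x)\<^sup>2 \<partial>M) \<le> e * (S / \<phi>_low)"
        using e by (intro mult_left_mono) auto
      also have "\<dots> = S / (2 * T)"
        using phi_low by (simp add: e_def)
      finally have le: "e * (\<integral>x. (\<rho> t x)\<^sup>2 \<partial>M) \<le> S / (2 * T)" .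
      have "c * (\<integral>x. norm (m t x) powr s \<partial>M) + 2 * (\<integral>x. \<phi> x * \<rho>' t x * \<rho> t x \<partial>M)
          \<le> K / e + K + e * (\<integral>x. (\<rho> t x)\<^sup>2 \<partial>M)"
        using * e by blast
      with le show "c * (\<integral>x. norm (m t x) powr s \<partial>M) + 2 * (\<integral>x. \<phi> x * \<rho>' t x * \<rho> t x \<partial>M) \<le> Y"
        unfolding Y_def by linarith
    qed
    have "0 \<le> (\<integral>x. norm (m t x) powr s \<partial>M)" for t
      by simp
    note est = energy_estimate[where Y = "\<lambda>_. Y", OF \<rho>' init(2) weak_solution_flux_power(2)[OF sol] this
        L.integrable_const Y0 less_imp_le[OF c] rate', folded E_def, unfolded E0 Y_int]
    have "E t \<le> A + S / 2" if "t \<in> {0..T}" for t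
      using est(1)[OF that] by (simp add: A_def)
    then have "S \<le> A + S / 2"
      unfolding S_def using T_pos by (intro cSUP_least) (auto simp flip: S_def)
    moreover have "c * (\<integral>t. \<integral>x. norm (m t x) powr s \<partial>M \<partial>L) \<le> A + S / 2"
      using est(2) by (simp add: A_def)
    ultimately show ?thesis
      using c by (simp add: field_simps)
  qed
  ultimately show thesis
    using that[of "2 * A / c"] c by simp
qed

text \<open>Each component is at most the Euclidean length, which is bounded by its essential
  supremum in \<open>x\<close> and then by the one in \<open>t\<close>. Both passages need
  measurability and a finite bound, or the real-valued norm could collapse to 0.\<close>

lemma AE_coeff_diff_le_coeff_dist:
  assumes a1: "admissible_coeff T \<Omega> N D b a1" and a2: "admissible_coeff T \<Omega> N D b a2"
  shows "AE t in L. AE x in M. \<forall>i\<in>{-1..int N}. \<bar>a1 t x i - a2 t x i\<bar> \<le> coeff_dist T \<Omega> N a1 a2"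
proof -
  let ?I = "{-1..int N}"
  define g where "g t x = L2_set (\<lambda>i. a1 t x i - a2 t x i) ?I" for t x
  define G where "G t = Linf_norm M (g t)" for t
  have g_meas [measurable]: "(\<lambda>(t, x). g t x) \<in> borel_measurable (L \<Otimes>\<^sub>M M)"
  proof -
    have "(\<lambda>z. a1 (fst z) (snd z) i - a2 (fst z) (snd z) i) \<in> borel_measurable (L \<Otimes>\<^sub>M M)" if "i \<in> ?I" for i
      using admissible_coeff_measurable[OF a1 that] admissible_coeff_measurable[OF a2 that]
      by (simp add: case_prod_beta')
    then have [measurable]: "(\<lambda>z. \<Sum>i\<in>?I. (a1 (fst z) (snd z) i - a2 (fst z) (snd z) i)\<^sup>2) \<in> borel_measurable (L \<Otimes>\<^sub>M M)"
      by (intro borel_measurable_sum borel_measurable_power)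
    show ?thesis
      unfolding g_def L2_set_def case_prod_beta' by measurable
  qed
  have g0: "0 \<le> g t x" for t x
    by (simp add: g_def)
  have "(\<lambda>t. esssup M (\<lambda>x. ereal (norm (g t x)))) \<in> borel_measurable L"
    by (rule M.measurable_esssup_slices) measurable
  then have G_meas: "(\<lambda>t. norm (G t)) \<in> borel_measurable L"
    unfolding G_def Linf_norm_def by measurable

  \<comment> \<open>Membership in the box bounds every component difference by \<open>amax\<close>;
    the size of this bound is immaterial, it only certifies finiteness.\<close>
  let ?B = "(real N + 2) * amax"
  have slice: "AE t in L. AE x in M. norm (g t x) \<le> ?B"
    using admissible_coeff_good[OF a1] admissible_coeff_good[OF a2]
  proof eventually_elim
    case (elim t)
    have "AE x in M. a1 t x \<in> coeff_box N amin amax" "AE x in M. a2 t x \<in> coeff_box N amin amax"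
      using elim by (auto simp: good_coeff_def)
    then show ?case
    proof eventually_elim
      case (elim x)
      have "g t x \<le> (\<Sum>i\<in>?I. \<bar>a1 t x i - a2 t x i\<bar>)"
        unfolding g_def by (rule L2_set_le_sum_abs)
      also have "\<dots> \<le> (\<Sum>i\<in>?I. amax)"
      proof (rule sum_mono)
        fix i assume "i \<in> ?I"
        then show "\<bar>a1 t x i - a2 t x i\<bar> \<le> amax"
          using coeff_box_bounds[OF elim(1), of i] coeff_box_bounds[OF elim(2), of i] by simp
      qed
      finally show ?case
        using g0 by (simp add: algebra_simps)
    qed
  qed
  have le_G: "AE t in L. AE x in M. g t x \<le> G t"
  proof (rule AE_mp[OF slice], rule AE_I2, rule impI)
    fix t assume t: "t \<in> space L" and le: "AE x in M. norm (g t x) \<le> ?B"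
    have "(\<lambda>x. norm (g t x)) \<in> borel_measurable M"
      using measurable_Pair2[OF g_meas t] by simp
    from AE_le_Linf_norm[OF this le] show "AE x in M. g t x \<le> G t"
      by (simp add: G_def g0)
  qed
  have "AE t in L. norm (G t) \<le> max 0 ?B"
    using slice
  proof eventually_elim
    case (elim t)
    have "G t \<le> max 0 ?B"
      unfolding G_def using elim by (intro Linf_norm_le) (auto elim: eventually_mono)
    then show ?case
      using Linf_norm_nonneg[of M "g t"] by (simp add: G_def)
  qed
  from AE_le_Linf_norm[OF G_meas this]
  have "AE t in L. norm (G t) \<le> coeff_dist T \<Omega> N a1 a2"
    by (simp add: coeff_dist_def Linf_Linf_norm_def G_def[abs_def] g_def[abs_def])
  with le_G show ?thesis
  proof eventually_elim
    case (elim t)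
    from elim(1) show ?case
    proof eventually_elim
      case (elim x)
      have "\<bar>a1 t x i - a2 t x i\<bar> \<le> g t x" if "i \<in> ?I" for i
        using member_le_L2_set[of ?I i "\<lambda>i. \<bar>a1 t x i - a2 t x i\<bar>"] that
        by (simp add: g_def L2_set_def)
      then show ?case
        using elim \<open>norm (G t) \<le> coeff_dist T \<Omega> N a1 a2\<close> by fastforce
    qed
  qed
qed

text \<open>The two conclusions of \<open>energy_estimate\<close>, applied to the difference, give
  the two terms on the left; their common right side is the time integral of \<open>Y\<close>,
  controlled by \<open>apriori_bound\<close> for the second solution.\<close>

lemma stability:
  "\<exists>C>0. \<forall>a1 a2 m1 m2 \<rho>1 \<rho>2.
     admissible_coeff T \<Omega> N D b a1 \<longrightarrow> admissible_coeff T \<Omega> N D b a2 \<longrightarrow>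
     weak_solution T \<Omega> N \<alpha> \<phi> f \<Psi> \<rho>0 a1 m1 \<rho>1 \<longrightarrow>
     weak_solution T \<Omega> N \<alpha> \<phi> f \<Psi> \<rho>0 a2 m2 \<rho>2 \<longrightarrow>
     (Linf_Lq_norm 2 T \<Omega> (\<lambda>t x. \<rho>1 t x - \<rho>2 t x))\<^sup>2
       + Lp_Lq_norm s s T \<Omega> (\<lambda>t x. m1 t x - m2 t x) powr s
     \<le> C * coeff_dist T \<Omega> N a1 a2 powr (s / (s - 1))"
proof -
  define c where "c = amin * 2 powr (1 - s)"
  have c: "0 < c" using amin_pos by (simp add: c_def)
  have s0: "0 < s" using s_gt_2 by simp
  obtain K where K: "0 \<le> K"
    and bound: "\<And>a m \<rho>. admissible_coeff T \<Omega> N D b a \<Longrightarrow> weak_solution T \<Omega> N \<alpha> \<phi> f \<Psi> \<rho>0 a m \<rho> \<Longrightarrow>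
      (\<integral>t. \<integral>x. norm (m t x) powr s \<partial>M \<partial>L) \<le> K"
    using apriori_bound by blast
  define Z where "Z = diff_const * (T * measure M \<Omega> + K)"
  have dc: "0 \<le> diff_const"
    by (simp add: diff_const_def)
  then have Z: "0 \<le> Z"
    using T_pos K by (simp add: Z_def)
  \<comment> \<open>The density costs \<open>1 / \<phi>_low\<close> for removing the weight, the
    flux \<open>1 / c\<close> for the monotonicity constant; the summand 1 makes \<open>C\<close>
    positive even if \<open>Z = 0\<close>.\<close>
  define C where "C = (1 / \<phi>_low + 1 / c) * Z + 1"
  have "0 < C"
    using Z phi_low c by (simp add: C_def add_nonneg_pos)
  moreover have "(Linf_Lq_norm 2 T \<Omega> (\<lambda>t x. \<rho>1 t x - \<rho>2 t x))\<^sup>2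
       + Lp_Lq_norm s s T \<Omega> (\<lambda>t x. m1 t x - m2 t x) powr s
     \<le> C * coeff_dist T \<Omega> N a1 a2 powr (s / (s - 1))"
    if a1: "admissible_coeff T \<Omega> N D b a1" and a2: "admissible_coeff T \<Omega> N D b a2"
      and sol1: "weak_solution T \<Omega> N \<alpha> \<phi> f \<Psi> \<rho>0 a1 m1 \<rho>1"
      and sol2: "weak_solution T \<Omega> N \<alpha> \<phi> f \<Psi> \<rho>0 a2 m2 \<rho>2"
    for a1 a2 m1 m2 \<rho>1 \<rho>2
  proof -
    define dist where "dist = coeff_dist T \<Omega> N a1 a2 powr (s / (s - 1))"
    obtain \<rho>1' where \<rho>1': "has_time_derivative T \<Omega> \<rho>1 \<rho>1'" "\<rho>1' \<in> Lp_Lq_space 1 2 T \<Omega>"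
      and at1: "AE t in L. \<exists>d. solves_at t (a1 t) (m1 t) (\<rho>1 t) (\<rho>1' t) d"
      using weak_solution_solves_at[OF a1 sol1] .
    obtain \<rho>2' where \<rho>2': "has_time_derivative T \<Omega> \<rho>2 \<rho>2'" "\<rho>2' \<in> Lp_Lq_space 1 2 T \<Omega>"
      and at2: "AE t in L. \<exists>d. solves_at t (a2 t) (m2 t) (\<rho>2 t) (\<rho>2' t) d"
      using weak_solution_solves_at[OF a2 sol2] .
    note init1 = weak_solution_initial[OF sol1] and init2 = weak_solution_initial[OF sol2]
    note pow1 = weak_solution_flux_power[OF sol1] and pow2 = weak_solution_flux_power[OF sol2]
    let ?\<rho> = "\<lambda>t x. \<rho>1 t x - \<rho>2 t x" and ?\<rho>' = "\<lambda>t x. \<rho>1' t x - \<rho>2' t x"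
    let ?m = "\<lambda>t x. m1 t x - m2 t x"
    define S where "S t = (\<integral>x. norm (?m t x) powr s \<partial>M)" for t
    define Y where "Y t = diff_const * dist * (measure M \<Omega> + (\<integral>x. norm (m2 t x) powr s \<partial>M))" for t

    have \<rho>_L2: "?\<rho> t \<in> Lp_space 2 M" if "t \<in> {0..T}" for t
      using init1(1)[OF that] init2(1)[OF that] by (rule Lp_space_diff_2)
    have S0: "0 \<le> S t" for t
      by (simp add: S_def)
    have [measurable]: "(\<lambda>(t, x). m1 t x) \<in> borel_measurable (L \<Otimes>\<^sub>M M)"
      "(\<lambda>(t, x). m2 t x) \<in> borel_measurable (L \<Otimes>\<^sub>M M)"
      using pow1(1) pow2(1) by (auto simp: Lp_Lq_space_def space_time_def)
    have m_Ls: "AE t in L. m1 t \<in> Lp_space s M" "AE t in L. m2 t \<in> Lp_space s M"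
      using pow1(1) pow2(1) by (auto simp: Lp_Lq_space_def)
    have S_int: "integrable L S"
    proof (rule Bochner_Integration.integrable_bound)
      show "integrable L (\<lambda>t. 2 powr s * ((\<integral>x. norm (m1 t x) powr s \<partial>M) + (\<integral>x. norm (m2 t x) powr s \<partial>M)))"
        using pow1(2) pow2(2) by simp
      show "S \<in> borel_measurable L"
        unfolding S_def[abs_def] by measurable
      show "AE t in L. norm (S t)
          \<le> norm (2 powr s * ((\<integral>x. norm (m1 t x) powr s \<partial>M) + (\<integral>x. norm (m2 t x) powr s \<partial>M)))"
        using m_Ls
      proof eventually_elim
        case (elim t)
        from Lp_space_diff(2)[OF elim s0] S0[of t] show ?case
          by (simp add: S_def)
      qed
    qed
    have Y_int: "integrable L Y"
      unfolding Y_def[abs_def] using pow2(2) by simp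
    have Y0: "0 \<le> Y t" for t
      using dc by (simp add: Y_def dist_def)
    have rate: "AE t in L. c * S t + 2 * (\<integral>x. \<phi> x * ?\<rho>' t x * ?\<rho> t x \<partial>M) \<le> Y t"
      using at1 at2 AE_coeff_diff_le_coeff_dist[OF a1 a2]
    proof eventually_elim
      case (elim t)
      then obtain d1 d2 where "solves_at t (a1 t) (m1 t) (\<rho>1 t) (\<rho>1' t) d1"
        "solves_at t (a2 t) (m2 t) (\<rho>2 t) (\<rho>2' t) d2" by blast
      from difference_rate[OF this elim(3)] show ?case
        by (simp add: c_def S_def Y_def dist_def)
    qed
    have \<rho>0_L2: "?\<rho> 0 \<in> Lp_space 2 M"
      using \<rho>_L2 T_pos by simp
    \<comment> \<open>Equal initial data enter here: the difference starts with zero energy, so only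
      the coefficient error drives it.\<close>
    have "AE x in M. \<phi> x * (?\<rho> 0 x)\<^sup>2 = 0"
      using init1(3) init2(3) by eventually_elim simp
    then have E0: "(\<integral>x. \<phi> x * (?\<rho> 0 x)\<^sup>2 \<partial>M) = 0"
      by (rule integral_eq_zero_AE)
    note est = energy_estimate[OF has_time_derivative_diff[OF \<rho>1'(1) \<rho>2'(1)]
        Lp_Lq_space_1_2_diff[OF \<rho>1'(2) \<rho>2'(2)] \<rho>0_L2 S_int S0 Y_int Y0 less_imp_le[OF c] rate,
        unfolded E0]
    have "(\<integral>t. Y t \<partial>L) = diff_const * dist * (T * measure M \<Omega> + (\<integral>t. \<integral>x. norm (m2 t x) powr s \<partial>M \<partial>L))"
      unfolding Y_def using pow2(2) T_pos by (simp add: measure_restrict_space)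
    also have "\<dots> \<le> diff_const * dist * (T * measure M \<Omega> + K)"
      using bound[OF a2 sol2] dc by (intro mult_left_mono) (auto simp: dist_def)
    finally have Y_le: "(\<integral>t. Y t \<partial>L) \<le> Z * dist"
      by (simp add: Z_def ac_simps)
    have Zd: "0 \<le> Z * dist"
      using Z by (simp add: dist_def)

    have "norm (Lp_norm 2 M (?\<rho> t)) \<le> sqrt (Z * dist / \<phi>_low)" if "t \<in> space L" for t
    proof -
      have t: "t \<in> {0..T}" using that by simp
      have "(\<integral>x. (?\<rho> t x)\<^sup>2 \<partial>M) \<le> Z * dist / \<phi>_low"
        using Lp_2_le_weighted[OF \<rho>_L2[OF t]] est(1)[OF t] Y_le phi_low
        by (simp add: field_simps)
      then show ?thesis
        by (simp add: Lp_norm_2_eq)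
    qed
    then have "Linf_Lq_norm 2 T \<Omega> ?\<rho> \<le> sqrt (Z * dist / \<phi>_low)"
      unfolding Linf_Lq_norm_def using Zd phi_low by (intro Linf_norm_le AE_I2) auto
    moreover have "0 \<le> Linf_Lq_norm 2 T \<Omega> ?\<rho>"
      unfolding Linf_Lq_norm_def by (rule Linf_norm_nonneg)
    ultimately have "(Linf_Lq_norm 2 T \<Omega> ?\<rho>)\<^sup>2 \<le> (sqrt (Z * dist / \<phi>_low))\<^sup>2"
      by (rule power_mono)
    then have density: "(Linf_Lq_norm 2 T \<Omega> ?\<rho>)\<^sup>2 \<le> Z * dist / \<phi>_low"
      using Zd phi_low by simp
    have "Lp_Lq_norm s s T \<Omega> ?m powr s = (\<integral>t. S t \<partial>L)"
      using s0 by (simp add: Lp_Lq_norm_def Lp_norm_powr Lp_norm_nonneg S_def)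
    also have "\<dots> \<le> Z * dist / c"
      using est(2) Y_le c by (simp add: field_simps)
    finally have "(Linf_Lq_norm 2 T \<Omega> ?\<rho>)\<^sup>2 + Lp_Lq_norm s s T \<Omega> ?m powr s
        \<le> (1 / \<phi>_low + 1 / c) * Z * dist"
      using density by (simp add: algebra_simps)
    also have "\<dots> \<le> C * dist"
      by (intro mult_right_mono) (auto simp: C_def dist_def)
    finally show ?thesis
      by (simp add: dist_def)
  qed
  ultimately show ?thesis by blast
qed

end

theorem theorem5p2:
  fixes \<Omega> :: "(real^'d) set"
    and T a_low a_up b_star \<phi>_low \<phi>_up \<alpha>0 s s_star :: real
    and N :: nat
    and \<alpha> :: "int \<Rightarrow> real"
    and D :: "(int \<Rightarrow> real) set"
    and \<phi> \<rho>0 :: "real^'d \<Rightarrow> real"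
    and f \<psi> \<Psi> :: "real \<Rightarrow> real^'d \<Rightarrow> real"
  assumes "CARD('d) \<ge> 2"
    and "open \<Omega>" and "bounded \<Omega>" and "C1_boundary \<Omega>"
    and "T > 0"
    and "N \<ge> 1"
    and "0 < \<alpha>0" and "\<alpha>0 < 1"
    and "\<alpha> (-1) = - \<alpha>0" and "\<alpha> 0 = 0" and "strict_mono_on {-1..int N} \<alpha>"
    and "0 < a_low" and "a_low \<le> a_up"
    and "compactin (product_topology (\<lambda>_. euclideanreal) {-1..int N}) D"
    and "D \<subseteq> coeff_box N a_low a_up"
    and "\<phi> \<in> borel_measurable (lebesgue_on \<Omega>)"
    and "0 < \<phi>_low" and "\<And>x. x \<in> \<Omega> \<Longrightarrow> \<phi>_low \<le> \<phi> x \<and> \<phi> x \<le> \<phi>_up"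
    and "f \<in> Linf_Lq_space 2 T \<Omega>"
    and "C12 \<Omega> T \<psi>" and "C12 \<Omega> T \<Psi>"
    and "\<And>t x. t \<in> {0..T} \<Longrightarrow> x \<in> frontier \<Omega> \<Longrightarrow> \<Psi> t x = \<psi> t x"
    and "s = \<alpha> (int N) + 2"
    and "s_star = s / (s - 1)"
  shows "\<exists>C>0. \<forall>a1 a2 m1 m2 \<rho>1 \<rho>2.
           admissible_coeff T \<Omega> N D b_star a1 \<longrightarrow>
           admissible_coeff T \<Omega> N D b_star a2 \<longrightarrow>
           weak_solution T \<Omega> N \<alpha> \<phi> f \<Psi> \<rho>0 a1 m1 \<rho>1 \<longrightarrow>
           weak_solution T \<Omega> N \<alpha> \<phi> f \<Psi> \<rho>0 a2 m2 \<rho>2 \<longrightarrow>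
           (Linf_Lq_norm 2 T \<Omega> (\<lambda>t x. \<rho>1 t x - \<rho>2 t x))\<^sup>2
             + Lp_Lq_norm s s T \<Omega> (\<lambda>t x. m1 t x - m2 t x) powr s
           \<le> C * coeff_dist T \<Omega> N a1 a2 powr s_star"
proof -
  have "space_time_domain \<Omega> T" "generalized_polynomial N \<alpha> a_low s"
    by (unfold_locales; use assms in simp)+
  then interpret weak_problem \<Omega> T N \<alpha> a_low a_up s D b_star \<phi>_low \<phi>_up \<phi> \<rho>0 f \<Psi>
    by (intro weak_problem.intro weak_problem_axioms.intro; use assms in simp)
  show ?thesis
    using stability unfolding \<open>s_star = s / (s - 1)\<close> .
qed

end
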